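(* Let $X$ be a graph-like continuum with $\mathcal{H}(X)<\infty$, let $B$ be Brownian motion on $X$, and for $t\ge0$ and continuous $f:X\to\mathbb{R}$ let $P_tf(x):=\mathbb{E}_x[f(B(t))]$, where $\mathbb{E}_x$ refers to $B$ started at $x\in X$. Then $(P_t)_{t\ge0}$ is a Feller semigroup. In particular, the process $B(t)$ satisfies the strong Markov property.
   Context: A continuum is a compact, connected, non-empty metrizable space; $X$ carries a fixed compatible metric $d$, and $\mathcal{H}$ is the 1-dimensional Hausdorff measure. An edge of $X$ is an open subspace $I\subseteq X$ homeomorphic to $(0,1)$ whose closure in $X$ is homeomorphic to $[0,1]$. $X$ is graph-like if there is a (possibly infinite) set $E$ of pairwise disjoint edges of $X$ such that $X\setminus\bigcup E$ is totally disconnected. A finite edge-set is a finite set of pairwise disjoint edges of $X$, also viewed as the union of these edges. A (finite) graph is a space homeomorphic to a finite simplicial 1-complex; a metric graph is a graph with positive edge lengths $\ell(e)$. A graph approximation of $X$ is a sequence $(G_n)_{n\in\mathbb{N}}$ of finite graphs that are subspaces of $X$ such that (i) for every edge $e\in E(G_n)$, the length $\ell(e)$ of $e$ in $G_n$ equals the length of the corresponding arc of $X$; (ii) for every finite edge-set $F$ of $X$ and every component $C$ of $X\setminus F$, for all but finitely many $i$ there is a unique component of $G_i\setminus F$ meeting $C$. Standard Brownian motion on a finite metric graph $G$ is the continuous strong Markov process that inside edges (parametrised by length) behaves like standard Brownian motion on a real interval (generator $\frac12 f''$), and at each vertex $v$ behaves like a Walsh spider with equiprobable legs: if $p_1,\dots,p_k$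 are points, one inside each edge incident with $v$, at distances $\ell_1,\dots,\ell_k$ from $v$ along the edge, the probability from $v$ of reaching $p_j$ first among the $p_i$ is $(1/\ell_j)/\sum_i(1/\ell_i)$; and the expected exit time from the ball of radius $r$ around $v$, starting at $v$, tends to $0$ as $r\to0$. Brownian motion $B$ on $X$ started at $o\in X$: the unique-in-law process with continuous sample paths in $X$ such that for every graph approximation $(G_n)$ of $X$ and all $o_n\in G_n$ with $o_n\to o$, standard Brownian motion $B_n$ on $G_n$ from $o_n$ converges weakly to $B$ (i.e. for every $T>0$ the laws on $C([0,T],X)$ with the supremum metric converge weakly). The existence and uniqueness of this process when $\mathcal{H}(X)<\infty$ is part of the setting. Feller semigroup on the compact space $X$: each $P_t$ maps $C(X)$ to $C(X)$, $P_{t+s}=P_tP_s$, and $P_tf(x)\to f(x)$ as $t\to0$ for every $f\in C(X)$ and $x\in X$. *)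

theory Defs
  imports "HOL-Analysis.Analysis" "HOL-Probability.Probability"
begin

section \<open>Graph-like continua\<close>

definition continuum :: "'a::metric_space set \<Rightarrow> bool" where
  "continuum X \<longleftrightarrow> compact X \<and> connected X \<and> X \<noteq> {}"

definition is_edge :: "'a::metric_space set \<Rightarrow> 'a set \<Rightarrow> bool" where
  "is_edge X I \<longleftrightarrow>
     openin (top_of_set X) I \<and>
     I homeomorphic {0<..<1::real} \<and>
     ((top_of_set X) closure_of I) homeomorphic {0..1::real}"

definition graph_like :: "'a::metric_space set \<Rightarrow> bool" where
  "graph_like X \<longleftrightarrow>
     (\<exists>E. (\<forall>e\<in>E. is_edge X e) \<and> pairwise disjnt E \<and>
          (\<forall>C\<in>components (X - \<Union>E). \<exists>x. C = {x}))"

definition finite_edge_set :: "'a::metric_space set \<Rightarrow> 'a set set \<Rightarrow> bool" where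
  "finite_edge_set X F \<longleftrightarrow> finite F \<and> pairwise disjnt F \<and> (\<forall>e\<in>F. is_edge X e)"

text \<open>The sets of a cover are required to be bounded because \<^const>\<open>diameter\<close> has no meaningful
  value on unbounded sets.\<close>

definition hausdorff1_pre :: "real \<Rightarrow> 'a::metric_space set \<Rightarrow> ennreal" where
  "hausdorff1_pre \<delta> A =
     (INF U\<in>{U :: nat \<Rightarrow> 'a set. A \<subseteq> (\<Union>i. U i) \<and> (\<forall>i. bounded (U i) \<and> diameter (U i) \<le> \<delta>)}.
        \<Sum>i. ennreal (diameter (U i)))"

definition hausdorff1 :: "'a::metric_space set \<Rightarrow> ennreal" where
  "hausdorff1 A = (SUP \<delta>\<in>{0<..}. hausdorff1_pre \<delta> A)"


section \<open>Metric graphs and graph approximations\<close>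

definition path_length :: "(real \<Rightarrow> 'a::metric_space) \<Rightarrow> real \<Rightarrow> real \<Rightarrow> ennreal" where
  "path_length \<gamma> a b =
     (SUP xs\<in>{xs. sorted xs \<and> set xs \<subseteq> {a..b}}.
        \<Sum>i<length xs - 1. ennreal (dist (\<gamma> (xs ! i)) (\<gamma> (xs ! Suc i))))"

definition has_arc_length :: "'a::metric_space set \<Rightarrow> real \<Rightarrow> bool" where
  "has_arc_length A L \<longleftrightarrow>
     (\<exists>g k. homeomorphism {0..1} A g k \<and> path_length g 0 1 = ennreal L)"

text \<open>Edges are open, i.e. they do not contain their endvertices.\<close>

record 'a metric_graph =
  verts :: "'a set"
  edges :: "'a set set"
  len :: "'a set \<Rightarrow> real"

definition gspace :: "'a metric_graph \<Rightarrow> 'a set" where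
  "gspace G = verts G \<union> \<Union>(edges G)"

text \<open>Every finite simplicial complex of dimension at most one has a realisation in
  three-dimensional space. Dimension zero is allowed so that a one-point continuum has a
  graph approximation.\<close>

definition metric_graph :: "'a::metric_space metric_graph \<Rightarrow> bool" where
  "metric_graph G \<longleftrightarrow>
     (\<exists>(K :: (real^3) set set) h k.
        simplicial_complex K \<and> (\<forall>\<sigma>\<in>K. aff_dim \<sigma> \<le> 1) \<and>
        homeomorphism (\<Union>K) (gspace G) h k \<and>
        verts G = {h p | p. {p} \<in> K} \<and>
        edges G = {h ` rel_interior \<sigma> | \<sigma>. \<sigma> \<in> K \<and> aff_dim \<sigma> = 1}) \<and>
     (\<forall>e\<in>edges G. 0 < len G e)"

definition graph_approximation :: "'a::metric_space set \<Rightarrow> (nat \<Rightarrow> 'a metric_graph) \<Rightarrow> bool" where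
  "graph_approximation X G \<longleftrightarrow>
     (\<forall>n. metric_graph (G n) \<and> gspace (G n) \<subseteq> X) \<and>
     (\<forall>n. \<forall>e\<in>edges (G n). has_arc_length (closure e) (len (G n) e)) \<and>
     (\<forall>F. finite_edge_set X F \<longrightarrow>
        (\<forall>C\<in>components (X - \<Union>F). \<forall>\<^sub>F i in sequentially.
           \<exists>!D. D \<in> components (gspace (G i) - \<Union>F) \<and> D \<inter> C \<noteq> {}))"


section \<open>Path space and strong Markov families\<close>

text \<open>Processes with continuous sample paths are represented by their laws on the canonical
  space of continuous paths with the \<open>\<sigma>\<close>-algebra generated by the evaluations.\<close>

definition path_space :: "'a::metric_space set \<Rightarrow> (real \<Rightarrow> 'a) measure" where
  "path_space S =
     restrict_space (PiM {0..} (\<lambda>_. restrict_space borel S)) {\<omega>. continuous_on {0..} \<omega>}"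

definition natural_filtration :: "'a::metric_space set \<Rightarrow> real \<Rightarrow> (real \<Rightarrow> 'a) measure" where
  "natural_filtration S s =
     vimage_algebra (space (path_space S)) (\<lambda>\<omega>. restrict \<omega> {0..s})
       (PiM {0..s} (\<lambda>_. restrict_space borel S))"

text \<open>The right-continuous filtration \<open>F\<^sub>t\<^sub>+ = (\<Inter>s>t. F\<^sub>s)\<close>, indexed by extended times so that
  stopping times may be infinite; at time \<open>\<infinity>\<close> it consists of all events.\<close>

definition path_filtration :: "'a::metric_space set \<Rightarrow> ennreal \<Rightarrow> (real \<Rightarrow> 'a) measure" where
  "path_filtration S t =
     sigma (space (path_space S))
       {A \<in> sets (path_space S). \<forall>s. t < ennreal s \<longrightarrow> A \<in> sets (natural_filtration S s)}"

definition shift :: "real \<Rightarrow> (real \<Rightarrow> 'a) \<Rightarrow> (real \<Rightarrow> 'a)" where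
  "shift s \<omega> = (\<lambda>t\<in>{0..}. \<omega> (s + t))"

text \<open>The last conjunct is the identity \<open>P\<^sub>x(\<theta>\<^sub>T \<omega> \<in> C | F\<^sub>T) = P\<^bsub>\<omega>(T)\<^esub>(C)\<close> on \<open>{T < \<infinity>}\<close>,
  integrated over the events \<open>A \<in> F\<^sub>T\<close>.\<close>

definition strong_markov_family ::
    "'a::metric_space set \<Rightarrow> ('a \<Rightarrow> (real \<Rightarrow> 'a) measure) \<Rightarrow> bool" where
  "strong_markov_family S P \<longleftrightarrow>
     P \<in> restrict_space borel S \<rightarrow>\<^sub>M prob_algebra (path_space S) \<and>
     (\<forall>x\<in>S. AE \<omega> in P x. \<omega> 0 = x) \<and>
     (\<forall>x\<in>S. \<forall>T. stopping_time (path_filtration S) T \<longrightarrow>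
        (\<forall>A \<in> sets (filtration.pre_sigma (space (path_space S)) (path_filtration S) T).
         \<forall>C \<in> sets (path_space S).
           emeasure (P x) {\<omega> \<in> A. T \<omega> < \<infinity> \<and> shift (enn2real (T \<omega>)) \<omega> \<in> C} =
           (\<integral>\<^sup>+\<omega>. emeasure (P (\<omega> (enn2real (T \<omega>)))) C * indicator {\<omega> \<in> A. T \<omega> < \<infinity>} \<omega> \<partial>P x)))"

lemma filtration_path_filtration: "filtration (space (path_space S)) (path_filtration S)"
proof
  fix t u :: ennreal
  let ?G = "\<lambda>t. {A \<in> sets (path_space S). \<forall>s. t < ennreal s \<longrightarrow> A \<in> sets (natural_filtration S s)}"
  have sub: "?G t \<subseteq> Pow (space (path_space S))" for t
    using sets.sets_into_space by fastforce
  show "space (path_filtration S t) = space (path_space S)"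
    unfolding path_filtration_def by (rule space_measure_of[OF sub])
  assume "t \<le> u"
  then have "?G t \<subseteq> ?G u" by (auto intro: le_less_trans)
  then show "sets (path_filtration S t) \<subseteq> sets (path_filtration S u)"
    unfolding path_filtration_def sets_measure_of[OF sub] by (rule sigma_sets_subseteq)
qed


section \<open>Brownian motion on finite metric graphs\<close>

definition wiener_law :: "real \<Rightarrow> (real \<Rightarrow> real) measure \<Rightarrow> bool" where
  "wiener_law a W \<longleftrightarrow>
     W \<in> space (prob_algebra (path_space UNIV)) \<and>
     (AE \<omega> in W. \<omega> 0 = a) \<and>
     (\<forall>s t. 0 \<le> s \<and> s < t \<longrightarrow>
        distributed W lborel (\<lambda>\<omega>. \<omega> t - \<omega> s) (\<lambda>y. ennreal (normal_density 0 (sqrt (t - s)) y))) \<and>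
     (\<forall>(n::nat) \<tau>. 0 \<le> \<tau> 0 \<and> mono \<tau> \<longrightarrow>
        prob_space.indep_vars W (\<lambda>_. borel) (\<lambda>i \<omega>. \<omega> (\<tau> (Suc i)) - \<omega> (\<tau> i)) {..<n})"

definition exit_time :: "'a set \<Rightarrow> (real \<Rightarrow> 'a) \<Rightarrow> ennreal" where
  "exit_time U \<omega> = (INF t\<in>{t. 0 \<le> t \<and> \<omega> t \<notin> U}. ennreal t)"

definition stop_at_exit :: "'a set \<Rightarrow> (real \<Rightarrow> 'a) \<Rightarrow> (real \<Rightarrow> 'a)" where
  "stop_at_exit U \<omega> = (\<lambda>t\<in>{0..}. \<omega> (enn2real (min (ennreal t) (exit_time U \<omega>))))"

text \<open>Parametrisation of a closed edge by length, for graphs whose edge lengths are the lengths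
  of the corresponding arcs.\<close>

definition length_param :: "'a::metric_space metric_graph \<Rightarrow> 'a set \<Rightarrow> (real \<Rightarrow> 'a) \<Rightarrow> bool" where
  "length_param G e \<gamma> \<longleftrightarrow>
     (\<exists>k. homeomorphism {0..len G e} (closure e) \<gamma> k) \<and>
     (\<forall>a b. 0 \<le> a \<and> a \<le> b \<and> b \<le> len G e \<longrightarrow> path_length \<gamma> a b = ennreal (b - a))"

definition incident :: "'a::metric_space metric_graph \<Rightarrow> 'a \<Rightarrow> 'a set set" where
  "incident G v = {e \<in> edges G. v \<in> closure e}"

text \<open>Started inside an edge, the process stopped when leaving the edge is real Brownian motion
  stopped when leaving the interval. (The clamping with \<open>max\<close> and \<open>min\<close> only affects paths that
  do not start in the interval, which have probability zero.)\<close>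

definition brownian_inside_edges ::
    "'a::metric_space metric_graph \<Rightarrow> ('a \<Rightarrow> (real \<Rightarrow> 'a) measure) \<Rightarrow> bool" where
  "brownian_inside_edges G P \<longleftrightarrow>
     (\<forall>e\<in>edges G. \<forall>\<gamma>. length_param G e \<gamma> \<longrightarrow>
       (\<forall>a\<in>{0<..<len G e}. \<exists>W. wiener_law a W \<and>
          distr (P (\<gamma> a)) (path_space (gspace G)) (stop_at_exit e) =
          distr W (path_space (gspace G))
            (\<lambda>\<omega>. \<lambda>t\<in>{0..}. \<gamma> (max 0 (min (len G e) (stop_at_exit {0<..<len G e} \<omega> t))))))"

text \<open>Behaviour at a vertex \<open>v\<close>: the exit probabilities of the equiprobable Walsh spider, exit
  times from small balls with vanishing expectation, and no time spent at \<open>v\<close>. The last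
  property, inherent to the Walsh spider, excludes sticky vertices, which satisfy the first
  two. At an isolated vertex there is nothing to require: continuous paths stay there.
  Vanishing of the expected exit times does not depend on whether balls are
  taken in the metric of the ambient space or in the length metric of the graph.\<close>

definition walsh_at_vertices ::
    "'a::metric_space metric_graph \<Rightarrow> ('a \<Rightarrow> (real \<Rightarrow> 'a) measure) \<Rightarrow> bool" where
  "walsh_at_vertices G P \<longleftrightarrow>
     (\<forall>v\<in>verts G. incident G v \<noteq> {} \<longrightarrow>
       (\<forall>\<gamma> l p. (\<forall>e\<in>incident G v. length_param G e (\<gamma> e) \<and> \<gamma> e 0 = v \<and>
                    0 < l e \<and> l e < len G e \<and> p e = \<gamma> e (l e)) \<longrightarrow>
          (\<forall>j\<in>incident G v.
             measure (P v) {\<omega> \<in> space (path_space (gspace G)).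
                \<exists>t\<ge>0. \<omega> t = p j \<and> (\<forall>s\<in>{0..<t}. \<forall>i\<in>incident G v. \<omega> s \<noteq> p i)} =
             (1 / l j) / (\<Sum>i\<in>incident G v. 1 / l i))) \<and>
       ((\<lambda>r. \<integral>\<^sup>+\<omega>. exit_time (ball v r) \<omega> \<partial>P v) \<longlongrightarrow> 0) (at_right 0) \<and>
       (AE \<omega> in P v. emeasure lborel {t. 0 \<le> t \<and> \<omega> t = v} = 0))"

definition graph_brownian_motion ::
    "'a::metric_space metric_graph \<Rightarrow> ('a \<Rightarrow> (real \<Rightarrow> 'a) measure) \<Rightarrow> bool" where
  "graph_brownian_motion G P \<longleftrightarrow>
     strong_markov_family (gspace G) P \<and> brownian_inside_edges G P \<and> walsh_at_vertices G P"


section \<open>Brownian motion on graph-like continua\<close>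

definition weakly_converges ::
    "'a::metric_space set \<Rightarrow> (nat \<Rightarrow> (real \<Rightarrow> 'a) measure) \<Rightarrow> (real \<Rightarrow> 'a) measure \<Rightarrow> bool" where
  "weakly_converges X N M \<longleftrightarrow>
     (\<forall>T>0. \<forall>\<Phi> :: (real \<Rightarrow> 'a) \<Rightarrow> real.
        let C = mtopology_of (cfunspace (top_of_set {0..T}) (submetric euclidean_metric X)) in
        continuous_map C euclideanreal \<Phi> \<and> bounded (\<Phi> ` topspace C) \<longrightarrow>
        (\<lambda>n. \<integral>\<omega>. \<Phi> (restrict \<omega> {0..T}) \<partial>N n) \<longlonglongrightarrow> (\<integral>\<omega>. \<Phi> (restrict \<omega> {0..T}) \<partial>M))"

definition brownian_limit_law ::
    "'a::metric_space set \<Rightarrow> 'a \<Rightarrow> (real \<Rightarrow> 'a) measure \<Rightarrow> bool" where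
  "brownian_limit_law X x M \<longleftrightarrow>
     M \<in> space (prob_algebra (path_space X)) \<and>
     (\<forall>G P xs. graph_approximation X G \<and> (\<forall>n. graph_brownian_motion (G n) (P n)) \<and>
        (\<forall>n. xs n \<in> gspace (G n)) \<and> xs \<longlonglongrightarrow> x \<longrightarrow>
        weakly_converges X (\<lambda>n. P n (xs n)) M)"

definition brownian_motion_law ::
    "'a::metric_space set \<Rightarrow> 'a \<Rightarrow> (real \<Rightarrow> 'a) measure \<Rightarrow> bool" where
  "brownian_motion_law X x M \<longleftrightarrow>
     brownian_limit_law X x M \<and> (\<forall>N. brownian_limit_law X x N \<longrightarrow> N = M)"


section \<open>Feller semigroups\<close>

definition feller_semigroup_on ::
    "'a::metric_space set \<Rightarrow> (real \<Rightarrow> ('a \<Rightarrow> real) \<Rightarrow> ('a \<Rightarrow> real)) \<Rightarrow> bool" where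
  "feller_semigroup_on X P \<longleftrightarrow>
     (\<forall>t\<ge>0. \<forall>f. continuous_on X f \<longrightarrow> continuous_on X (P t f)) \<and>
     (\<forall>t\<ge>0. \<forall>s\<ge>0. \<forall>f. continuous_on X f \<longrightarrow> (\<forall>x\<in>X. P (t + s) f x = P t (P s f) x)) \<and>
     (\<forall>f. continuous_on X f \<longrightarrow> (\<forall>x\<in>X. ((\<lambda>t. P t f x) \<longlongrightarrow> f x) (at_right 0)))"

end

theory Submission
  imports Defs
begin

text \<open>
  Fix one graph approximation \<open>G\<^sub>n\<close> with Brownian motions \<open>P\<^sub>n\<close>. Removing finitely many edges of a
  graph-like continuum isolates components of arbitrarily small diameter around any point, so the
  graphs \<open>G\<^sub>n\<close> become dense in \<open>X\<close> and every \<open>x \<in> X\<close> is a limit of points of the \<open>G\<^sub>n\<close>. For a functional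
  \<open>\<Phi>(\<omega>) = f\<^sub>1(\<omega>(t\<^sub>1)) \<cdot> \<dots> \<cdot> f\<^sub>k(\<omega>(t\<^sub>k))\<close> with continuous \<open>f\<^sub>i\<close>, the expectations of \<open>\<Phi>\<close> under \<open>P\<^sub>n\<close> converge
  along every such sequence of starting points (``continuous convergence''); by compactness the
  limit \<open>x \<mapsto> E\<^sub>x \<Phi>\<close> is continuous and the convergence is uniform on \<open>G\<^sub>n\<close>. Uniformity lets one pass to
  the limit in the Markov property of \<open>P\<^sub>n\<close> tested against such functionals. The strong Markov property
  with respect to the right-continuous filtration then follows by approximating a stopping time
  from above by discrete ones, using continuity of \<open>x \<mapsto> E\<^sub>x \<Phi>\<close> and of the paths.
\<close>

section \<open>Density of graph approximations\<close>

text \<open>Weak convergence is available along every sequence of starting points \<open>y n\<close>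
  tending to \<open>x\<close>, and this is the source of regularity: convergence from one fixed
  choice of points would not tell how expectations depend on \<open>x\<close>. The obstacle in
  passing to the limit in the Markov identity is that its right-hand side depends on
  \<open>n\<close> twice, through the outer law and through the inner expectation, which is
  evaluated at the random point reached at time \<open>s\<close>. Weak convergence of the outer law
  does not cover this. Uniform convergence replaces the inner expectation by its limit at small
  cost, and what remains is a fixed continuous functional of the path. Only deterministic times are
  treated in this way. A stopping time is in general not a continuous functional of the path, so the
  strong Markov property cannot be passed to the limit directly and is rebuilt on \<open>X\<close>
  afterwards. Products of functions of single coordinates serve as tests because they are continuous
  for the supremum metric and, by approximating indicators of closed sets, determine a finite
  measure on path space.\<close>

text \<open>The singleton component of \<open>x\<close> in the compact set
  \<open>X - \<Union>E\<close> yields a clopen splitting of that set. The part of \<open>X\<close>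
  not controlled by open neighbourhoods of the two halves lies inside edges, and compactness reduces
  these to finitely many.\<close>

lemma small_component_off_edges:
  fixes X :: "'a::metric_space set"
  assumes X: "compact X" and E: "\<And>e. e \<in> E \<Longrightarrow> is_edge X e" "pairwise disjnt E"
    and comps: "\<And>C. C \<in> components (X - \<Union>E) \<Longrightarrow> \<exists>x. C = {x}"
    and x: "x \<in> X - \<Union>E" and "0 < \<epsilon>"
  obtains F where "finite_edge_set X F" "x \<in> X - \<Union>F"
    "connected_component_set (X - \<Union>F) x \<subseteq> ball x \<epsilon>"
proof -
  define K where "K = X - \<Union>E"
  have opE: "openin (top_of_set X) e" if "e \<in> E" for e
    using E(1)[OF that] by (simp add: is_edge_def)
  have "openin (top_of_set X) (\<Union>E)"
    using opE by blast
  then have "closedin (top_of_set X) K"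
    unfolding K_def by (simp add: closedin_diff)
  then have K: "compact K"
    using X closedin_compact by blast
  have single: "connected_component_set K x = {x}"
  proof -
    have "x \<in> K" using x by (simp add: K_def)
    then obtain z where "connected_component_set K x = {z}"
      using comps[of "connected_component_set K x"] componentsI[of x K] by (auto simp: K_def)
    moreover have "x \<in> connected_component_set K x"
      using \<open>x \<in> K\<close> by (simp add: connected_component_refl_eq)
    ultimately show ?thesis by auto
  qed
  have "connected_component_of_set (top_of_set K) x = {x}"
    using single unfolding connected_component_of_def connected_component_def connectedin_subtopology
      connectedin_iff_connected by (simp only: conj_assoc)
  then have C: "{x} \<in> connected_components_of (top_of_set K)"
    using x connected_component_in_connected_components_of[of "top_of_set K" x] by (auto simp: K_def)
  have "locally_compact_space (top_of_set K)"
    by (simp add: K compact_imp_locally_compact_space compact_space_subtopology)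
  moreover have "Hausdorff_space (top_of_set K)"
    by (simp add: Hausdorff_space_subtopology)
  moreover have "compactin (top_of_set K) {x}"
    using x by (simp add: K_def)
  moreover have "openin (top_of_set K) (K \<inter> ball x \<epsilon>)"
    by (simp add: openin_open_Int)
  \<comment> \<open>In a compact Hausdorff space a component is an intersection of clopen sets, so
    the component \<open>{x}\<close> has arbitrarily small clopen neighbourhoods; \<open>U\<close>
    is one inside the ball.\<close>
  ultimately obtain U V where UV: "openin (top_of_set K) U" "openin (top_of_set K) V" "disjnt U V"
    "U \<union> V = K" "{x} \<subseteq> U" "U \<subseteq> K \<inter> ball x \<epsilon>"
    using wilder_locally_compact_component_thm[of "top_of_set K" "{x}" "K \<inter> ball x \<epsilon>"] C x \<open>0 < \<epsilon>\<close>
    by (auto simp: K_def)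
  have "U = K - V" "V = K - U"
    using UV(3,4) by (auto simp: disjnt_def)
  then have cUV: "compact U" "compact V"
    using K closedin_compact[OF K] closedin_diff[OF closedin_topspace UV(1)] closedin_diff[OF closedin_topspace UV(2)]
    by auto
  obtain U' V' where U'V': "open U'" "open V'" "U \<subseteq> U'" "V \<subseteq> V'" "U' \<inter> V' = {}"
    using t4_space[of U V] cUV UV(3) by (auto simp: compact_imp_closed disjnt_def)
  define W where "W = U' \<inter> ball x \<epsilon>"
  have W: "open W" "U \<subseteq> W" "W \<inter> V' = {}" "W \<subseteq> ball x \<epsilon>"
    using U'V' UV(6) by (auto simp: W_def)
  \<comment> \<open>Since \<open>W\<close> and \<open>V'\<close> together contain \<open>K\<close>,
    this compact remainder is covered by the edges.\<close>
  have "compact (X - (W \<union> V'))"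
    using X W(1) U'V'(2) by (simp add: compact_diff open_Un)
  moreover obtain O' where O': "\<And>e. e \<in> E \<Longrightarrow> open (O' e) \<and> e = X \<inter> O' e"
    using opE unfolding openin_open by metis
  moreover have "X - (W \<union> V') \<subseteq> (\<Union>e\<in>E. O' e)"
    using W(2) U'V'(4) UV(4) O' unfolding K_def by blast
  ultimately obtain F where F: "F \<subseteq> E" "finite F" "X - (W \<union> V') \<subseteq> (\<Union>e\<in>F. O' e)"
    using compactE_image[of "X - (W \<union> V')" E O'] by (smt (verit))
  have sub: "X - \<Union>F \<subseteq> W \<union> V'"
    using F(1,3) O' by blast
  show thesis
  proof
    show "finite_edge_set X F"
      using F E unfolding finite_edge_set_def by (meson pairwise_mono subset_eq)
    show xF: "x \<in> X - \<Union>F"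
      using x F(1) by blast
    let ?C = "connected_component_set (X - \<Union>F) x"
    have "?C \<subseteq> W \<union> V'"
      using sub connected_component_subset by blast
    moreover have "x \<in> W \<inter> ?C"
      using W(2) UV(5) xF by (auto simp: connected_component_refl_eq)
    ultimately have "V' \<inter> ?C = {}"
      using connectedD[OF connected_connected_component W(1) U'V'(2), of "X - \<Union>F" x] W(3) by blast
    then show "?C \<subseteq> ball x \<epsilon>"
      using \<open>?C \<subseteq> W \<union> V'\<close> W(4) by blast
  qed
qed

text \<open>Keeping \<open>a\<close> and \<open>b\<close> away from 0 and 1 keeps the closure of the
  subarc inside \<open>e\<close>, where the parametrisation is injective and continuous; by
  compactness that closure is the image of \<open>{a..b}\<close>.\<close>

lemma subarc_is_edge:
  fixes X :: "'a::metric_space set"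
  assumes "openin (top_of_set X) e" and hom: "homeomorphism {0<..<1::real} e \<phi> \<psi>"
    and "0 < a" "a < b" "b < 1"
  shows "is_edge X (\<phi> ` {a<..<b})"
proof -
  have eX: "e \<subseteq> X"
    using assms(1) by (rule openin_imp_subset)
  have sub: "{a..b} \<subseteq> {0<..<1}"
    using assms by auto
  have cont: "continuous_on {a..b} \<phi>"
    using hom sub by (meson continuous_on_subset homeomorphism_cont1)
  have inj: "inj_on \<phi> {a..b}"
    using hom sub by (metis homeomorphism_def inj_on_inverseI inj_on_subset)
  have "openin (top_of_set e) (\<phi> ` {a<..<b})"
    using homeomorphism_imp_open_map[OF hom, of "{a<..<b}"] sub
    by (simp add: open_subset greaterThanLessThan_subseteq_atLeastAtMost_iff subset_iff)
  then have op: "openin (top_of_set X) (\<phi> ` {a<..<b})"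
    using assms(1) openin_trans by blast
  have "{a<..<b} homeomorphic \<phi> ` {a<..<b}"
    using homeomorphism_of_subsets[OF hom, of "{a<..<b}" "{}"] sub
    unfolding homeomorphic_def by fastforce
  moreover have "{a<..<b} homeomorphic {0<..<1::real}"
    using assms(4) homeomorphic_open_interval_UNIV[of a b] homeomorphic_open_interval_UNIV[of 0 1]
    by (metis homeomorphic_sym homeomorphic_trans zero_less_one)
  ultimately have 1: "\<phi> ` {a<..<b} homeomorphic {0<..<1::real}"
    using homeomorphic_sym homeomorphic_trans by blast
  have "\<phi> ` {a..b} \<subseteq> e"
    using hom sub by (auto simp: homeomorphism_def)
  then have img: "\<phi> ` {a..b} \<subseteq> X"
    using eX by auto
  have cl: "closure (\<phi> ` {a<..<b}) = \<phi> ` {a..b}"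
  proof
    show "closure (\<phi> ` {a<..<b}) \<subseteq> \<phi> ` {a..b}"
      using cont by (intro closure_minimal compact_imp_closed compact_continuous_image) auto
    have "\<phi> ` closure {a<..<b} \<subseteq> closure (\<phi> ` {a<..<b})"
      using cont assms(4) by (intro image_closure_subset) (auto intro: closure_subset[THEN subsetD])
    then show "\<phi> ` {a..b} \<subseteq> closure (\<phi> ` {a<..<b})"
      using assms(4) by simp
  qed
  have "(top_of_set X) closure_of (\<phi> ` {a<..<b}) = \<phi> ` {a..b}"
    using img cl op[THEN openin_imp_subset] by (auto simp: closure_of_subtopology Int_absorb1)
  moreover have "{a..b} homeomorphic \<phi> ` {a..b}"
    using cont inj homeomorphic_compact by blast
  moreover have "{a..b} homeomorphic {0..1::real}"
    using homeomorphic_closed_intervals_real[of a b 0 1] assms(4) by simp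
  ultimately have "(top_of_set X) closure_of (\<phi> ` {a<..<b}) homeomorphic {0..1::real}"
    by (metis homeomorphic_sym homeomorphic_trans)
  then show ?thesis
    using op 1 by (simp add: is_edge_def)
qed

lemma connected_subset_clopen:
  assumes "connected C" "C \<subseteq> S" "openin (top_of_set S) M" "closedin (top_of_set S) M"
    and "x \<in> C" "x \<in> M"
  shows "C \<subseteq> M"
proof -
  obtain O' D where "open O'" "M = S \<inter> O'" "closed D" "M = S \<inter> D"
    using assms(3,4) by (auto simp: openin_open closedin_closed)
  then have "C \<inter> M = C \<inter> O'" "C \<inter> M = C \<inter> D"
    using assms(2) by auto
  then have "openin (top_of_set C) (C \<inter> M)" "closedin (top_of_set C) (C \<inter> M)"
    using \<open>open O'\<close> \<open>closed D\<close> openin_open_Int closedin_closed_Int by metis+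
  then show ?thesis
    using assms(1,5,6) unfolding connected_clopen by blast
qed

text \<open>Removing \<open>e\<close> itself would remove \<open>x\<close>. Instead two small open
  subarcs are cut out, one on each side of \<open>x\<close>, and the closed subarc between them
  becomes clopen in the rest.\<close>

lemma small_component_in_edge:
  fixes X :: "'a::metric_space set"
  assumes X: "compact X" and e: "is_edge X e" "x \<in> e" and "0 < \<epsilon>"
  obtains F where "finite_edge_set X F" "x \<in> X - \<Union>F"
    "connected_component_set (X - \<Union>F) x \<subseteq> ball x \<epsilon>"
proof -
  have op: "openin (top_of_set X) e"
    using e by (simp add: is_edge_def)
  obtain \<phi> \<psi> where hom: "homeomorphism {0<..<1::real} e \<phi> \<psi>"
    using e(1) unfolding is_edge_def homeomorphic_def by (meson homeomorphism_symD)
  define a where "a = \<psi> x"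
  have a: "a \<in> {0<..<1}" "\<phi> a = x"
    using hom e(2) by (auto simp: homeomorphism_def a_def)
  have inj: "inj_on \<phi> {0<..<1}"
    using hom by (metis homeomorphism_def inj_on_inverseI)
  obtain \<delta> where \<delta>: "\<delta> > 0" "\<And>t. t \<in> {0<..<1} \<Longrightarrow> dist t a < \<delta> \<Longrightarrow> dist (\<phi> t) x < \<epsilon>"
    using homeomorphism_cont1[OF hom] a \<open>0 < \<epsilon>\<close> unfolding continuous_on_iff by (metis (no_types, lifting))
  \<comment> \<open>Division by 3 leaves room for the cuts, which reach out to
    \<open>a - 2*h\<close> and \<open>a + 2*h\<close>: these points stay strictly inside the unit
    interval and within \<open>\<delta>\<close> of \<open>a\<close>.\<close>
  define h where "h = min \<delta> (min a (1 - a)) / 3"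
  have h: "h > 0" "3 * h \<le> \<delta>" "3 * h \<le> a" "3 * h \<le> 1 - a"
    using \<delta> a by (auto simp: h_def)
  let ?A = "\<phi> ` {a - 2*h<..<a - h}" and ?B = "\<phi> ` {a + h<..<a + 2*h}"
  let ?M = "\<phi> ` {a - h..a + h}" and ?N = "\<phi> ` {a - 2*h<..<a + 2*h}"
  have edges: "is_edge X ?A" "is_edge X ?B" "is_edge X ?N"
    using h a by (auto intro!: subarc_is_edge[OF op hom])
  define F where "F = {?A, ?B}"
  have "?A \<inter> ?B = \<phi> ` ({a - 2*h<..<a - h} \<inter> {a + h<..<a + 2*h})"
    using h by (intro inj_on_image_Int[OF inj, symmetric]) auto
  also have "{a - 2*h<..<a - h} \<inter> {a + h<..<a + 2*h} = {}"
    using h(1) by auto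
  finally have "disjnt ?A ?B"
    by (simp add: disjnt_def)
  then have F: "finite_edge_set X F"
    using edges by (auto simp: finite_edge_set_def F_def pairwise_def disjnt_sym)
  have "?N - ?A - ?B = \<phi> ` ({a - 2*h<..<a + 2*h} - {a - 2*h<..<a - h} - {a + h<..<a + 2*h})"
    using h inj_on_image_set_diff[OF inj, of "{a - 2*h<..<a + 2*h}" "{a - 2*h<..<a - h}"]
      inj_on_image_set_diff[OF inj, of "{a - 2*h<..<a + 2*h} - {a - 2*h<..<a - h}" "{a + h<..<a + 2*h}"]
    by (auto simp: subset_iff)
  also have "{a - 2*h<..<a + 2*h} - {a - 2*h<..<a - h} - {a + h<..<a + 2*h} = {a - h..a + h}"
    using h(1) by auto
  finally have NM: "?N - \<Union>F = ?M"
    by (auto simp: F_def)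
  have NX: "?N \<subseteq> X"
    using edges(3) openin_imp_subset unfolding is_edge_def by blast
  \<comment> \<open>\<open>?M\<close> is open in the rest because it is what the cuts leave of the
    open subarc \<open>?N\<close>; it is closed there because it is compact.\<close>
  have "openin (top_of_set (X - \<Union>F)) ((X - \<Union>F) \<inter> ?N)"
  proof (rule openin_subtopology_Int_subset)
    show "openin (top_of_set X) (X \<inter> ?N)"
      using edges(3) unfolding is_edge_def Int_absorb1[OF NX] by (rule conjunct1)
  qed blast
  then have "openin (top_of_set (X - \<Union>F)) ?M"
    unfolding Int_commute[of "X - \<Union>F"] Int_Diff Int_absorb2[OF NX]
    by (simp only: Int_Diff[symmetric] NM Int_absorb2[OF NX])
  moreover have "closedin (top_of_set (X - \<Union>F)) ?M"
  proof -
    have "continuous_on {a - h..a + h} \<phi>"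
      by (rule continuous_on_subset[OF homeomorphism_cont1[OF hom]]) (use h in auto)
    then have "closed ?M"
      by (intro compact_imp_closed compact_continuous_image) auto
    moreover have "?M \<subseteq> X - \<Union>F"
      using NM NX by blast
    ultimately show ?thesis
      by (simp add: closed_subset)
  qed
  moreover have "x \<in> ?M"
    using a(2) h(1) by (intro image_eqI[of _ _ a]) auto
  ultimately have "connected_component_set (X - \<Union>F) x \<subseteq> ?M"
    by (intro connected_subset_clopen[OF connected_connected_component connected_component_subset])
      (auto simp: connected_component_refl_eq dest: closedin_imp_subset)
  moreover have "?M \<subseteq> ball x \<epsilon>"
    using \<delta>(2) h by (auto simp: dist_commute dist_real_def abs_le_iff)
  ultimately show thesis
    using that[OF F] \<open>x \<in> ?M\<close> NM NX by blast
qed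

lemma graph_approximation_dense:
  fixes X :: "'a::metric_space set"
  assumes X: "compact X" "graph_like X" and G: "graph_approximation X G"
    and ne: "\<And>n. gspace (G n) \<noteq> {}" and x: "x \<in> X"
  obtains y where "\<And>n. y n \<in> gspace (G n)" "y \<longlonglongrightarrow> x"
proof -
  obtain E where E: "\<And>e. e \<in> E \<Longrightarrow> is_edge X e" "pairwise disjnt E"
      "\<And>C. C \<in> components (X - \<Union>E) \<Longrightarrow> \<exists>x. C = {x}"
    using X(2) unfolding graph_like_def by metis
  have near: "\<forall>\<^sub>F n in sequentially. \<exists>y\<in>gspace (G n). dist y x < \<epsilon>" if "0 < \<epsilon>" for \<epsilon>
  proof -
    have "\<exists>F. finite_edge_set X F \<and> x \<in> X - \<Union>F \<and>
        connected_component_set (X - \<Union>F) x \<subseteq> ball x \<epsilon>"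
    proof (cases "x \<in> \<Union>E")
      case True
      then obtain e where "e \<in> E" "x \<in> e" by blast
      with small_component_in_edge[OF X(1) E(1) _ that] show ?thesis
        by metis
    next
      case False
      then have "x \<in> X - \<Union>E" using x by blast
      from small_component_off_edges[OF X(1) E this that] show ?thesis
        by metis
    qed
    then obtain F where F: "finite_edge_set X F" "x \<in> X - \<Union>F"
        "connected_component_set (X - \<Union>F) x \<subseteq> ball x \<epsilon>"
      by blast
    \<comment> \<open>For large \<open>n\<close> some component of the graph minus \<open>F\<close>
      meets this small component, which places a point of the graph in the ball.\<close>
    have "connected_component_set (X - \<Union>F) x \<in> components (X - \<Union>F)"
      using F(2) by (rule componentsI)
    then have "\<forall>\<^sub>F n in sequentially. \<exists>!D. D \<in> components (gspace (G n) - \<Union>F) \<and>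
        D \<inter> connected_component_set (X - \<Union>F) x \<noteq> {}"
      using G F(1) unfolding graph_approximation_def by blast
    then show ?thesis
    proof eventually_elim
      case (elim n)
      then obtain D y where "D \<in> components (gspace (G n) - \<Union>F)" "y \<in> D"
        "y \<in> connected_component_set (X - \<Union>F) x"
        by blast
      then show ?case
        using F(3) in_components_subset by (fastforce simp: dist_commute)
    qed
  qed
  \<comment> \<open>A point is needed in every graph, not only in late ones, and no radius is
    prescribed for a given \<open>n\<close>. An almost nearest point to \<open>x\<close>, with slack
    tending to 0, serves all \<open>n\<close> at once.\<close>
  have "\<exists>y\<in>gspace (G n). dist y x < infdist x (gspace (G n)) + inverse (real (Suc n))" for n
  proof -
    have "Inf ((\<lambda>y. dist x y) ` gspace (G n)) < infdist x (gspace (G n)) + inverse (real (Suc n))"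
      using ne[of n] by (simp add: infdist_notempty)
    from cInf_lessD[OF _ this] ne[of n] show ?thesis
      by (auto simp: dist_commute)
  qed
  then obtain y where y: "\<And>n. y n \<in> gspace (G n)"
      "\<And>n. dist (y n) x < infdist x (gspace (G n)) + inverse (real (Suc n))"
    by metis
  have "(\<lambda>n. infdist x (gspace (G n))) \<longlonglongrightarrow> 0"
  proof (rule tendstoI)
    fix \<epsilon> :: real assume "0 < \<epsilon>"
    from near[OF this] show "\<forall>\<^sub>F n in sequentially. dist (infdist x (gspace (G n))) 0 < \<epsilon>"
    proof eventually_elim
      case (elim n)
      then show ?case
        using infdist_le infdist_nonneg by (metis dist_commute dist_real_def diff_zero abs_of_nonneg le_less_trans)
    qed
  qed
  then have "(\<lambda>n. infdist x (gspace (G n)) + inverse (real (Suc n))) \<longlonglongrightarrow> 0"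
    using tendsto_add[OF _ LIMSEQ_inverse_real_of_nat] by fastforce
  then have "(\<lambda>n. dist (y n) x) \<longlonglongrightarrow> 0"
    by (rule Lim_null_comparison[rotated]) (use y(2) in \<open>auto intro!: always_eventually less_imp_le\<close>)
  then show thesis
    using that y(1) tendsto_dist_iff by blast
qed

section \<open>Continuous convergence\<close>

text \<open>If this failed, offending points could be spread over a sparse set of indices and
  completed by the given sequence \<open>z\<close> to a full sequence converging to
  \<open>x\<close>, against the hypothesis.\<close>

lemma continuous_convergence_near:
  fixes X :: "'a::metric_space set" and S :: "nat \<Rightarrow> 'a set" and u :: "'a \<Rightarrow> real"
  assumes conv: "\<And>y. (\<And>n. y n \<in> S n) \<Longrightarrow> y \<longlonglongrightarrow> x \<Longrightarrow> (\<lambda>n. v n (y n)) \<longlonglongrightarrow> u x"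
    and z: "\<And>n. z n \<in> S n" "z \<longlonglongrightarrow> x" and "0 < \<epsilon>"
  shows "\<exists>\<delta> N. 0 < \<delta> \<and> (\<forall>n\<ge>N. \<forall>y\<in>S n. dist y x < \<delta> \<longrightarrow> \<bar>v n y - u x\<bar> < \<epsilon>)"
proof (rule ccontr)
  assume "\<not> ?thesis"
  then have bad: "\<exists>n y. N \<le> n \<and> y \<in> S n \<and> dist y x < \<delta> \<and> \<bar>v n y - u x\<bar> \<ge> \<epsilon>" if "\<delta> > 0" for N \<delta>
    using that by (metis not_less)
  define Q where "Q k n y \<longleftrightarrow> y \<in> S n \<and> dist y x < inverse (real (Suc k)) \<and> \<bar>v n y - u x\<bar> \<ge> \<epsilon>" for k n y
  \<comment> \<open>Strict growth of \<open>r\<close> ensures that each index \<open>n\<close>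
    receives at most one offending point, so that the sequence below is well defined by inverting
    \<open>r\<close>.\<close>
  have "\<exists>r. \<forall>k. (\<exists>y. Q k (r k) y) \<and> r k < r (Suc k)"
  proof (rule dependent_nat_choice)
    show "\<exists>n. \<exists>y. Q 0 n y"
      using bad[of "inverse (real (Suc 0))" 0] unfolding Q_def by auto
    show "\<exists>m. (\<exists>y. Q (Suc k) m y) \<and> n < m" for n k
      using bad[of "inverse (real (Suc (Suc k)))" "Suc n"] unfolding Q_def by (auto simp: Suc_le_eq)
  qed
  then obtain r b where Q: "\<And>k. Q k (r k) (b k)" and "\<And>k. r k < r (Suc k)"
    by metis
  then have r: "strict_mono r"
    by (simp add: strict_mono_Suc_iff)
  define y where "y n = (if n \<in> range r then b (inv r n) else z n)" for n
  have yr: "y (r k) = b k" for k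
    using strict_mono_imp_inj_on[OF r] by (simp add: y_def)
  have yS: "y n \<in> S n" for n
  proof (cases "n \<in> range r")
    case True
    then show ?thesis using yr Q unfolding Q_def by auto
  qed (simp add: y_def z)
  have "y \<longlonglongrightarrow> x"
  proof (rule tendstoI)
    fix e :: real assume "0 < e"
    then obtain K where K: "inverse (real (Suc K)) < e"
      using reals_Archimedean by blast
    show "\<forall>\<^sub>F n in sequentially. dist (y n) x < e"
      using tendstoD[OF z(2) \<open>0 < e\<close>] eventually_ge_at_top[of "r K"]
    proof eventually_elim
      case (elim n)
      show ?case
      proof (cases "n \<in> range r")
        case True
        then obtain k where k: "n = r k" by auto
        then have "K \<le> k"
          using elim(2) r by (simp add: strict_mono_less_eq)
        then have "inverse (real (Suc k)) \<le> inverse (real (Suc K))"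
          by (intro le_imp_inverse_le) auto
        then show ?thesis
          using Q[of k] K unfolding Q_def k yr by linarith
      qed (use elim in \<open>simp add: y_def\<close>)
    qed
  qed
  then have "(\<lambda>n. v n (y n)) \<longlonglongrightarrow> u x"
    using conv yS by blast
  then have "(\<lambda>k. v (r k) (b k)) \<longlonglongrightarrow> u x"
    using LIMSEQ_subseq_LIMSEQ[OF _ r] by (fastforce simp: o_def yr)
  then have "\<forall>\<^sub>F k in sequentially. dist (v (r k) (b k)) (u x) < \<epsilon>"
    using \<open>0 < \<epsilon>\<close> tendstoD by blast
  then obtain k where "\<bar>v (r k) (b k) - u x\<bar> < \<epsilon>"
    by (auto simp: eventually_sequentially dist_real_def)
  then show False
    using Q[of k] by (simp add: Q_def)
qed

text \<open>Both conclusions rest on the same local estimate: near \<open>x\<close>, all late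
  \<open>v n\<close> are close to the single number \<open>u x\<close>. Passing to the limit in
  \<open>n\<close> transfers the estimate to \<open>u\<close>, and a finite subcover makes it
  uniform.\<close>

lemma
  fixes X :: "'a::metric_space set" and S :: "nat \<Rightarrow> 'a set" and u :: "'a \<Rightarrow> real"
  assumes X: "compact X" and S: "\<And>n. S n \<subseteq> X"
    and dense: "\<And>x. x \<in> X \<Longrightarrow> \<exists>y. (\<forall>n. y n \<in> S n) \<and> y \<longlonglongrightarrow> x"
    and conv: "\<And>x y. x \<in> X \<Longrightarrow> (\<And>n. y n \<in> S n) \<Longrightarrow> y \<longlonglongrightarrow> x \<Longrightarrow> (\<lambda>n. v n (y n)) \<longlonglongrightarrow> u x"
  shows continuous_convergence_imp_continuous: "continuous_on X u"
    and continuous_convergence_imp_uniform: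
      "0 < \<epsilon> \<Longrightarrow> \<forall>\<^sub>F n in sequentially. \<forall>y\<in>S n. \<bar>v n y - u y\<bar> < \<epsilon>"
proof -
  have near: "\<exists>\<delta> N. 0 < \<delta> \<and> (\<forall>n\<ge>N. \<forall>y\<in>S n. dist y x < \<delta> \<longrightarrow> \<bar>v n y - u x\<bar> < \<epsilon>)"
    if x: "x \<in> X" and "0 < \<epsilon>" for x \<epsilon>
  proof -
    obtain z where z: "\<And>n. z n \<in> S n" "z \<longlonglongrightarrow> x" using dense x by metis
    show ?thesis
      using conv[OF x] z \<open>0 < \<epsilon>\<close> by (rule continuous_convergence_near)
  qed
  \<comment> \<open>The point \<open>y\<close> is itself a limit of points of the
    \<open>S n\<close>, which eventually lie in the open ball around \<open>x\<close>; the estimate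
    on \<open>v n\<close> survives in the limit with a weak inequality.\<close>
  have near': "\<bar>u y - u x\<bar> \<le> \<epsilon>"
    if "y \<in> X" "dist y x < \<delta>" "\<forall>n\<ge>N. \<forall>y\<in>S n. dist y x < \<delta> \<longrightarrow> \<bar>v n y - u x\<bar> < \<epsilon>" for x y \<delta> N \<epsilon>
  proof -
    obtain z where z: "\<And>n. z n \<in> S n" "z \<longlonglongrightarrow> y" using dense \<open>y \<in> X\<close> by metis
    have "(\<lambda>n. \<bar>v n (z n) - u x\<bar>) \<longlonglongrightarrow> \<bar>u y - u x\<bar>"
      by (intro tendsto_intros conv that(1) z)
    moreover have "(\<lambda>n. dist (z n) x) \<longlonglongrightarrow> dist y x"
      by (intro tendsto_intros z)
    then have "\<forall>\<^sub>F n in sequentially. dist (z n) x < \<delta>"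
      using that(2) by (rule order_tendstoD)
    then have "\<forall>\<^sub>F n in sequentially. \<bar>v n (z n) - u x\<bar> \<le> \<epsilon>"
      using eventually_ge_at_top[of N]
      by eventually_elim (use that(3) z in \<open>auto intro: less_imp_le\<close>)
    ultimately show ?thesis
      by (intro tendsto_upperbound) auto
  qed
  show "continuous_on X u"
    unfolding continuous_on_iff
  proof (intro ballI allI impI)
    fix x and \<epsilon> :: real assume "x \<in> X" "0 < \<epsilon>"
    then obtain \<delta> N where "0 < \<delta>" "\<forall>n\<ge>N. \<forall>y\<in>S n. dist y x < \<delta> \<longrightarrow> \<bar>v n y - u x\<bar> < \<epsilon> / 2"
      using near[of x "\<epsilon> / 2"] by auto
    then have "\<forall>y\<in>X. dist y x < \<delta> \<longrightarrow> \<bar>u y - u x\<bar> \<le> \<epsilon> / 2"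
      using near' by blast
    then show "\<exists>\<delta>>0. \<forall>y\<in>X. dist y x < \<delta> \<longrightarrow> dist (u y) (u x) < \<epsilon>"
      using \<open>0 < \<delta>\<close> \<open>0 < \<epsilon>\<close> by (intro exI[of _ \<delta>]) (fastforce simp: dist_real_def)
  qed
  show "\<forall>\<^sub>F n in sequentially. \<forall>y\<in>S n. \<bar>v n y - u y\<bar> < \<epsilon>" if "0 < \<epsilon>"
  proof -
    have "\<forall>x\<in>X. \<exists>\<delta> N. 0 < \<delta> \<and> (\<forall>n\<ge>N. \<forall>y\<in>S n. dist y x < \<delta> \<longrightarrow> \<bar>v n y - u x\<bar> < \<epsilon> / 2)"
      using near[of _ "\<epsilon> / 2"] \<open>0 < \<epsilon>\<close> by auto
    then obtain \<delta> N where \<delta>: "\<And>x. x \<in> X \<Longrightarrow> 0 < \<delta> x"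
      "\<And>x n y. x \<in> X \<Longrightarrow> N x \<le> n \<Longrightarrow> y \<in> S n \<Longrightarrow> dist y x < \<delta> x \<Longrightarrow> \<bar>v n y - u x\<bar> < \<epsilon> / 2"
      by metis
    have "X \<subseteq> (\<Union>x\<in>X. ball x (\<delta> x))"
      using \<delta>(1) by auto
    then obtain D where D: "D \<subseteq> X" "finite D" "X \<subseteq> (\<Union>x\<in>D. ball x (\<delta> x))"
      using compactE_image[OF X, of X "\<lambda>x. ball x (\<delta> x)"] by auto
    have "\<forall>\<^sub>F n in sequentially. \<forall>x\<in>D. N x \<le> n"
      using D(2) by (simp add: eventually_ball_finite eventually_ge_at_top)
    then show ?thesis
    proof eventually_elim
      case (elim n)
      show ?case
      proof
        fix y assume y: "y \<in> S n"
        then obtain x where x: "x \<in> D" "dist y x < \<delta> x"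
          using S[of n] D(3) by (fastforce simp: dist_commute)
        have "\<bar>v n y - u x\<bar> < \<epsilon> / 2"
          using \<delta>(2)[of x n y] x y elim D(1) by auto
        moreover have "\<bar>u y - u x\<bar> \<le> \<epsilon> / 2"
          using near'[of y x "\<delta> x" "N x" "\<epsilon> / 2"] \<delta>(2)[of x] x y S[of n] D(1) by auto
        ultimately show "\<bar>v n y - u y\<bar> < \<epsilon>" by linarith
      qed
    qed
  qed
qed

section \<open>Path space and cylinder functionals\<close>

lemma space_path_space:
  "space (path_space X) = {\<omega> \<in> {0..} \<rightarrow>\<^sub>E X. continuous_on {0..} \<omega>}"
  by (auto simp: path_space_def space_restrict_space space_PiM)

lemma path_in: "\<omega> \<in> space (path_space X) \<Longrightarrow> 0 \<le> t \<Longrightarrow> \<omega> t \<in> X"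
  by (auto simp: space_path_space PiE_iff)

lemma restrict_path_space:
  assumes "I \<subseteq> {0..}"
  shows "(\<lambda>\<omega>. restrict \<omega> I) \<in> space (path_space X) \<rightarrow> space (PiM I (\<lambda>_. restrict_space borel X))"
  unfolding space_PiM space_restrict_space
  by (intro Pi_I restrict_PiE_iff[THEN iffD2] ballI) (use assms path_in in auto)

lemma path_continuous: "\<omega> \<in> space (path_space X) \<Longrightarrow> continuous_on {0..} \<omega>"
  by (simp add: space_path_space)

lemma measurable_path_eval:
  assumes "0 \<le> t"
  shows "(\<lambda>\<omega>. \<omega> t) \<in> path_space X \<rightarrow>\<^sub>M restrict_space borel X"
  unfolding path_space_def
  by (intro measurable_restrict_space1 measurable_component_singleton) (use assms in auto)

lemma measurable_path_eval_borel:
  assumes "0 \<le> t"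
  shows "(\<lambda>\<omega>. \<omega> t) \<in> path_space X \<rightarrow>\<^sub>M borel"
  using measurable_path_eval[OF assms, of X] unfolding measurable_restrict_space2_iff by simp

lemma measurable_path_spaceI:
  assumes "f \<in> space M \<rightarrow> space (path_space X)"
    and "\<And>t. 0 \<le> t \<Longrightarrow> (\<lambda>\<omega>. f \<omega> t) \<in> borel_measurable M"
  shows "f \<in> M \<rightarrow>\<^sub>M path_space X"
  unfolding path_space_def
proof (intro measurable_restrict_space2 measurable_PiM_single)
  show "f \<in> space M \<rightarrow> {\<omega>. continuous_on {0..} \<omega>}"
    using assms(1) by (auto simp: space_path_space)
  show "f \<in> space M \<rightarrow> (\<Pi>\<^sub>E i\<in>{0..}. space (restrict_space borel X))"
    using assms(1) by (auto simp: space_path_space space_restrict_space)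
  fix A and i :: real assume i: "i \<in> {0..}" and "A \<in> sets (restrict_space borel X)"
  then obtain A' where A': "A' \<in> sets borel" "A = X \<inter> A'"
    by (auto simp: sets_restrict_space)
  have "{\<omega> \<in> space M. f \<omega> i \<in> A'} \<in> sets M"
    using assms(2)[of i] i A'(1) by (simp add: measurable_sets Collect_conj_eq vimage_def measurable_def Int_commute)
  also have "{\<omega> \<in> space M. f \<omega> i \<in> A'} = {\<omega> \<in> space M. f \<omega> i \<in> A}"
    using assms(1) i A' path_in[of _ X i] by (auto simp: Pi_iff)
  finally show "{\<omega> \<in> space M. f \<omega> i \<in> A} \<in> sets M" .
qed

section \<open>Closed cylinders as generators of the path sigma-algebras\<close>

definition cylinder :: "'a::metric_space set \<Rightarrow> real set \<Rightarrow> (real \<Rightarrow> 'a set) \<Rightarrow> (real \<Rightarrow> 'a) set" where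
  "cylinder X J F = {\<omega> \<in> space (path_space X). \<forall>j\<in>J. \<omega> j \<in> F j}"

text \<open>Closed constraints are a compromise: they generate the Borel sets and are stable under
  intersection, and their indicators are pointwise limits of continuous functions. The index set
  \<open>I\<close> allows for both the full path space and the past up to a fixed time.\<close>

definition closed_cylinders :: "'a::metric_space set \<Rightarrow> real set \<Rightarrow> (real \<Rightarrow> 'a) set set" where
  "closed_cylinders X I = {cylinder X J F | J F. finite J \<and> J \<subseteq> I \<and> (\<forall>j\<in>J. closed (F j))}"

lemma closed_cylindersE:
  assumes "A \<in> closed_cylinders X I"
  obtains J F where "finite J" "J \<subseteq> I" "\<forall>j\<in>J. closed (F j)" "A = cylinder X J F"
  using assms by (auto simp: closed_cylinders_def)

lemma closed_cylinders_subset: "closed_cylinders X I \<subseteq> Pow (space (path_space X))"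
  by (auto simp: closed_cylinders_def cylinder_def)

lemma closed_cylinders_mono: "I \<subseteq> I' \<Longrightarrow> closed_cylinders X I \<subseteq> closed_cylinders X I'"
  unfolding closed_cylinders_def by blast

lemma space_in_closed_cylinders: "space (path_space X) \<in> closed_cylinders X I"
  by (auto simp: closed_cylinders_def cylinder_def intro!: exI[of _ "{}"])

lemma Int_stable_closed_cylinders: "Int_stable (closed_cylinders X I)"
proof (rule Int_stableI)
  fix A B assume "A \<in> closed_cylinders X I" "B \<in> closed_cylinders X I"
  then obtain J F K H where A: "A = cylinder X J F" "finite J" "J \<subseteq> I" "\<forall>j\<in>J. closed (F j)"
    and B: "B = cylinder X K H" "finite K" "K \<subseteq> I" "\<forall>j\<in>K. closed (H j)"
    by (auto simp: closed_cylinders_def)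
  define L where "L j = (if j \<in> J then F j else UNIV) \<inter> (if j \<in> K then H j else UNIV)" for j
  have "A \<inter> B = cylinder X (J \<union> K) L"
    unfolding A B cylinder_def L_def by auto
  moreover have "\<forall>j\<in>J \<union> K. closed (L j)"
    using A(4) B(4) by (auto simp: L_def)
  ultimately show "A \<inter> B \<in> closed_cylinders X I"
    unfolding closed_cylinders_def using A B by blast
qed

text \<open>One computation covers all cases: \<open>I = {0..s}\<close> gives the natural filtration
  at \<open>s\<close>, and \<open>I = {0..}\<close> the whole path space. Closed sets generate the
  Borel sets, so cylinders with a single constraint already make every coordinate in
  \<open>I\<close> measurable.\<close>

lemma
  assumes "I \<subseteq> {0..}"
  shows space_restrict_algebra: "space (vimage_algebra (space (path_space X)) (\<lambda>\<omega>. restrict \<omega> I)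
      (PiM I (\<lambda>_. restrict_space borel X))) = space (path_space X)"
    and sets_restrict_algebra: "sets (vimage_algebra (space (path_space X)) (\<lambda>\<omega>. restrict \<omega> I)
      (PiM I (\<lambda>_. restrict_space borel X))) = sigma_sets (space (path_space X)) (closed_cylinders X I)"
      (is "sets ?V = sigma_sets ?\<Omega> ?C")
proof -
  show spV: "space ?V = ?\<Omega>" by simp
  let ?N = "sigma ?\<Omega> ?C"
  have N: "space ?N = ?\<Omega>" "sets ?N = sigma_sets ?\<Omega> ?C"
    using closed_cylinders_subset[of X I] by (simp_all add: space_measure_of sets_measure_of)
  have maps: "(\<lambda>\<omega>. restrict \<omega> I) \<in> ?\<Omega> \<rightarrow> space (PiM I (\<lambda>_. restrict_space borel X))"
    using assms by (rule restrict_path_space)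
  have eval: "(\<lambda>\<omega>. \<omega> i) \<in> ?V \<rightarrow>\<^sub>M borel" if "i \<in> I" for i
  proof -
    have "(\<lambda>\<omega>. restrict \<omega> I i) \<in> ?V \<rightarrow>\<^sub>M restrict_space borel X"
      by (rule measurable_compose[OF measurable_vimage_algebra1[OF maps] measurable_component_singleton[OF that]])
    then show ?thesis
      using that unfolding measurable_restrict_space2_iff by simp
  qed
  show "sets ?V = sigma_sets ?\<Omega> ?C"
  proof
    have "(\<lambda>\<omega>. restrict \<omega> I) \<in> ?N \<rightarrow>\<^sub>M PiM I (\<lambda>_. restrict_space borel X)"
    proof (rule measurable_PiM_single')
      show "(\<lambda>\<omega>. restrict \<omega> I) \<in> space ?N \<rightarrow> (\<Pi>\<^sub>E i\<in>I. space (restrict_space borel X))"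
        using maps by (simp add: space_PiM N(1))
      fix i assume i: "i \<in> I"
      have "(\<lambda>\<omega>. \<omega> i) \<in> ?N \<rightarrow>\<^sub>M borel"
        unfolding borel_eq_closed
      proof (rule measurable_measure_of)
        fix A :: "'a set" assume A: "A \<in> Collect closed"
        have "(\<lambda>\<omega>. \<omega> i) -` A \<inter> space ?N = cylinder X {i} (\<lambda>_. A)"
          by (auto simp: cylinder_def N(1))
        also have "\<dots> \<in> ?C"
          using A i by (auto simp: closed_cylinders_def)
        finally show "(\<lambda>\<omega>. \<omega> i) -` A \<inter> space ?N \<in> sets ?N"
          unfolding N by auto
      qed auto
      then have "(\<lambda>\<omega>. \<omega> i) \<in> ?N \<rightarrow>\<^sub>M restrict_space borel X"
        by (rule measurable_restrict_space2[rotated]) (use assms i N(1) in \<open>auto intro: path_in\<close>)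
      then show "(\<lambda>\<omega>. restrict \<omega> I i) \<in> ?N \<rightarrow>\<^sub>M restrict_space borel X"
        using i by simp
    qed
    from sets_image_in_sets[OF N(1) this] show "sets ?V \<subseteq> sigma_sets ?\<Omega> ?C"
      by (simp add: N)
    show "sigma_sets ?\<Omega> ?C \<subseteq> sets ?V"
    proof (rule sets.sigma_sets_subset[of _ ?V, unfolded spV])
      show "?C \<subseteq> sets ?V"
      proof
        fix A assume "A \<in> ?C"
        then obtain J F where A: "A = cylinder X J F" "finite J" "J \<subseteq> I" "\<forall>j\<in>J. closed (F j)"
          by (auto simp: closed_cylinders_def)
        have "{\<omega> \<in> space ?V. \<forall>j\<in>J. \<omega> j \<in> F j} \<in> sets ?V"
        proof (rule sets.sets_Collect_finite_All[OF _ A(2)])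
          fix j assume "j \<in> J"
          then have "(\<lambda>\<omega>. \<omega> j) -` F j \<inter> space ?V \<in> sets ?V"
            using A eval by (intro measurable_sets[of _ _ borel]) auto
          then show "{\<omega> \<in> space ?V. \<omega> j \<in> F j} \<in> sets ?V"
            by (simp add: vimage_def Int_def conj_commute)
        qed
        then show "A \<in> sets ?V"
          by (simp add: A(1) cylinder_def)
      qed
    qed
  qed
qed

lemma space_natural_filtration: "space (natural_filtration X s) = space (path_space X)"
  by (simp add: natural_filtration_def)

lemma sets_natural_filtration:
  "sets (natural_filtration X s) = sigma_sets (space (path_space X)) (closed_cylinders X {0..s})"
  unfolding natural_filtration_def by (rule sets_restrict_algebra) auto

lemma sets_path_space:
  "sets (path_space X) = sigma_sets (space (path_space X)) (closed_cylinders X {0..})"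
proof -
  let ?\<Omega> = "space (path_space X)"
  let ?V = "vimage_algebra ?\<Omega> (\<lambda>\<omega>. restrict \<omega> {0..}) (PiM {0..} (\<lambda>_. restrict_space borel X))"
  \<comment> \<open>Paths are extensional on \<open>{0..}\<close>, so restricting them to
    \<open>{0..}\<close> changes nothing and the general description applies.\<close>
  have "sets (path_space X) = sets ?V"
  proof
    have "(\<lambda>\<omega>. \<omega>) \<in> ?V \<rightarrow>\<^sub>M path_space X"
    proof (rule measurable_path_spaceI)
      fix t :: real assume t: "0 \<le> t"
      have "(\<lambda>\<omega>. restrict \<omega> {0..} t) \<in> ?V \<rightarrow>\<^sub>M restrict_space borel X"
      proof (rule measurable_compose[OF measurable_vimage_algebra1 measurable_component_singleton])
        show "(\<lambda>\<omega>. restrict \<omega> {0..}) \<in> ?\<Omega> \<rightarrow> space (PiM {0..} (\<lambda>_. restrict_space borel X))"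
          by (rule restrict_path_space) auto
      qed (use t in simp)
      then show "(\<lambda>\<omega>. \<omega> t) \<in> borel_measurable ?V"
        using t unfolding measurable_restrict_space2_iff by simp
    qed auto
    then show "sets (path_space X) \<subseteq> sets ?V"
      unfolding measurable_def by (auto dest: sets.sets_into_space simp: Int_absorb2)
    show "sets ?V \<subseteq> sets (path_space X)"
    proof (intro sets_image_in_sets measurable_PiM_single')
      show "(\<lambda>\<omega>. restrict \<omega> {0..}) \<in> space (path_space X) \<rightarrow> (\<Pi>\<^sub>E i\<in>{0..}. space (restrict_space borel X))"
        using restrict_path_space[of "{0..}" X] by (simp add: space_PiM)
      fix i :: real assume "i \<in> {0..}"
      then show "(\<lambda>\<omega>. restrict \<omega> {0..} i) \<in> path_space X \<rightarrow>\<^sub>M restrict_space borel X"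
        using measurable_path_eval[of i X] by simp
    qed simp
  qed
  then show ?thesis
    using sets_restrict_algebra[of "{0..}" X] by simp
qed

lemma natural_filtration_subset: "sets (natural_filtration X s) \<subseteq> sets (path_space X)"
  unfolding sets_natural_filtration sets_path_space
  by (intro sigma_sets_subseteq closed_cylinders_mono) auto

lemma natural_filtration_mono: "s \<le> t \<Longrightarrow> sets (natural_filtration X s) \<subseteq> sets (natural_filtration X t)"
  unfolding sets_natural_filtration
  by (intro sigma_sets_subseteq closed_cylinders_mono) auto

lemma closed_cylinder_in_sets: "A \<in> closed_cylinders X {0..} \<Longrightarrow> A \<in> sets (path_space X)"
  unfolding sets_path_space by auto

section \<open>Continuous approximation of closed cylinders\<close>

text \<open>The value is 1 on \<open>F\<close> and, for positive \<open>m\<close>, vanishes at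
  distance at least \<open>1/m\<close> from it. The empty set is separated because
  \<open>infdist\<close> to it is 0 by convention, so that the formula would give the constant 1
  instead of 0.\<close>

definition bump :: "'a::metric_space set \<Rightarrow> nat \<Rightarrow> 'a \<Rightarrow> real" where
  "bump F m x = (if F = {} then 0 else max 0 (1 - real m * infdist x F))"

lemma bump_range: "0 \<le> bump F m x" "bump F m x \<le> 1"
  by (auto simp: bump_def infdist_nonneg)

lemma continuous_bump: "continuous_on A (bump F m)"
  unfolding bump_def by (cases "F = {}") (auto intro!: continuous_intros)

lemma bump_tendsto:
  assumes "closed F"
  shows "(\<lambda>m. bump F m x) \<longlonglongrightarrow> indicator F x"
proof (cases "x \<in> F")
  case True
  then have "bump F m x = 1" for m by (auto simp: bump_def)
  then show ?thesis using True by simp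
next
  case False
  show ?thesis
  proof (cases "F = {}")
    case False
    then have pos: "infdist x F > 0"
      using assms \<open>x \<notin> F\<close> infdist_pos_not_in_closed by blast
    obtain N where N: "1 < real N * infdist x F"
      using pos ex_less_of_nat_mult by blast
    have "\<forall>\<^sub>F m in sequentially. bump F m x = 0"
      using eventually_ge_at_top[of N]
    proof eventually_elim
      case (elim m)
      then have "real N * infdist x F \<le> real m * infdist x F"
        using pos by (intro mult_right_mono) auto
      then show ?case using N \<open>F \<noteq> {}\<close> by (simp add: bump_def)
    qed
    then show ?thesis
      using \<open>x \<notin> F\<close> by (simp add: tendsto_eventually)
  qed (auto simp: bump_def)
qed

text \<open>Values in the unit interval keep all finite products there. The constant 1 then
  dominates every integrand, and integrals of real and of extended nonnegative functions can be
  exchanged freely.\<close>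

definition unit_functions :: "real set \<Rightarrow> (real \<Rightarrow> 'a::metric_space \<Rightarrow> real) \<Rightarrow> bool" where
  "unit_functions J f \<longleftrightarrow> (\<forall>j\<in>J. continuous_on UNIV (f j) \<and> (\<forall>x. 0 \<le> f j x \<and> f j x \<le> 1))"

lemma unit_functions_prod:
  assumes "unit_functions J f"
  shows "0 \<le> (\<Prod>j\<in>J. f j (\<omega> j))" "(\<Prod>j\<in>J. f j (\<omega> j)) \<le> 1"
  using assms by (auto simp: unit_functions_def intro!: prod_nonneg prod_le_1)

lemma measurable_prod_functional:
  fixes f :: "real \<Rightarrow> 'a::metric_space \<Rightarrow> real"
  assumes "unit_functions J f" and "\<And>j. j \<in> J \<Longrightarrow> (\<lambda>\<omega>. \<omega> j) \<in> M \<rightarrow>\<^sub>M borel"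
  shows "(\<lambda>\<omega>. \<Prod>j\<in>J. f j (\<omega> j)) \<in> borel_measurable M"
proof (rule borel_measurable_prod)
  fix j assume j: "j \<in> J"
  have "f j \<in> borel \<rightarrow>\<^sub>M borel"
    using assms(1) j by (intro borel_measurable_continuous_onI) (auto simp: unit_functions_def)
  from measurable_compose[OF assms(2)[OF j] this] show "(\<lambda>\<omega>. f j (\<omega> j)) \<in> borel_measurable M" .
qed

lemma prod_bump_tendsto:
  assumes "finite J" "\<forall>j\<in>J. closed (F j)" "\<omega> \<in> space (path_space X)"
  shows "(\<lambda>m. \<Prod>j\<in>J. bump (F j) m (\<omega> j)) \<longlonglongrightarrow> indicator (cylinder X J F) \<omega>"
proof -
  have "(\<lambda>m. \<Prod>j\<in>J. bump (F j) m (\<omega> j)) \<longlonglongrightarrow> (\<Prod>j\<in>J. indicator (F j) (\<omega> j))"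
    using assms(2) by (intro tendsto_prod bump_tendsto) auto
  also have "(\<Prod>j\<in>J. indicator (F j) (\<omega> j)) = (indicator (cylinder X J F) \<omega> :: real)"
    using assms(1,3) by (auto simp: cylinder_def indicator_def)
  finally show ?thesis .
qed

lemma unit_functions_bump: "unit_functions J (\<lambda>j. bump (F j) m)"
  by (simp add: unit_functions_def bump_range continuous_bump)

lemma eval_measurable_sigma_cylinders:
  assumes "sets M = sigma_sets (space (path_space X)) (closed_cylinders X I)" "I \<subseteq> {0..}" "i \<in> I"
  shows "(\<lambda>\<omega>. \<omega> i) \<in> M \<rightarrow>\<^sub>M borel"
proof -
  let ?V = "vimage_algebra (space (path_space X)) (\<lambda>\<omega>. restrict \<omega> I) (PiM I (\<lambda>_. restrict_space borel X))"
  have "(\<lambda>\<omega>. restrict \<omega> I i) \<in> ?V \<rightarrow>\<^sub>M restrict_space borel X"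
  proof (rule measurable_compose[OF measurable_vimage_algebra1 measurable_component_singleton])
    show "(\<lambda>\<omega>. restrict \<omega> I) \<in> space (path_space X) \<rightarrow> space (PiM I (\<lambda>_. restrict_space borel X))"
      using assms(2) by (rule restrict_path_space)
  qed fact
  then have "(\<lambda>\<omega>. \<omega> i) \<in> ?V \<rightarrow>\<^sub>M borel"
    using assms(3) unfolding measurable_restrict_space2_iff by simp
  moreover have "sets M = sets ?V"
    using assms sets_restrict_algebra[OF assms(2), of X] by simp
  ultimately show ?thesis
    using measurable_cong_sets by blast
qed

lemma nn_integral_prod_bump_tendsto:
  assumes "finite_measure M" and M: "sets M = sigma_sets (space (path_space X)) (closed_cylinders X I)"
    and I: "I \<subseteq> {0..}" and J: "finite J" "J \<subseteq> I" "\<forall>j\<in>J. closed (F j)"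
  shows "(\<lambda>m. \<integral>\<^sup>+\<omega>. ennreal (\<Prod>j\<in>J. bump (F j) m (\<omega> j)) \<partial>M) \<longlonglongrightarrow> emeasure M (cylinder X J F)"
proof -
  interpret finite_measure M by fact
  have sp: "space M = space (path_space X)"
    using M sets_restrict_algebra[OF I, of X] space_restrict_algebra[OF I, of X] by (metis sets_eq_imp_space_eq)
  have A: "cylinder X J F \<in> sets M"
    unfolding M using J by (auto simp: closed_cylinders_def)
  have "(\<lambda>m. \<integral>\<^sup>+\<omega>. ennreal (\<Prod>j\<in>J. bump (F j) m (\<omega> j)) \<partial>M)
      \<longlonglongrightarrow> (\<integral>\<^sup>+\<omega>. ennreal (indicator (cylinder X J F) \<omega>) \<partial>M)"
  proof (rule nn_integral_dominated_convergence[where w = "\<lambda>_. 1"])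
    show "(\<lambda>\<omega>. ennreal (\<Prod>j\<in>J. bump (F j) m (\<omega> j))) \<in> borel_measurable M" for m
      using eval_measurable_sigma_cylinders[OF M I] J
      by (intro measurable_compose[OF measurable_prod_functional measurable_ennreal] unit_functions_bump) auto
    show "(\<lambda>\<omega>. ennreal (indicator (cylinder X J F) \<omega>)) \<in> borel_measurable M"
      using A by simp
    show "AE \<omega> in M. (\<lambda>m. ennreal (\<Prod>j\<in>J. bump (F j) m (\<omega> j))) \<longlonglongrightarrow> ennreal (indicator (cylinder X J F) \<omega>)"
      using J by (intro AE_I2 tendsto_ennrealI prod_bump_tendsto) (auto simp: sp)
    show "AE \<omega> in M. ennreal (\<Prod>j\<in>J. bump (F j) m (\<omega> j)) \<le> 1" for m
      using unit_functions_prod(2)[OF unit_functions_bump] by (intro AE_I2) (simp add: ennreal_le_1)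
  qed (auto simp: emeasure_finite less_top[symmetric])
  also have "(\<integral>\<^sup>+\<omega>. ennreal (indicator (cylinder X J F) \<omega>) \<partial>M) = emeasure M (cylinder X J F)"
    using A by (simp add: ennreal_indicator)
  finally show ?thesis .
qed

text \<open>Products of bumps decrease the question to closed cylinders by dominated convergence.
  These form an intersection-stable generator containing the whole space, which determines a finite
  measure.\<close>

lemma measure_eqI_cylinder_functionals:
  assumes fin: "finite_measure M" "finite_measure N"
    and M: "sets M = sigma_sets (space (path_space X)) (closed_cylinders X I)"
    and N: "sets N = sigma_sets (space (path_space X)) (closed_cylinders X I)"
    and I: "I \<subseteq> {0..}"
    and eq: "\<And>J f. finite J \<Longrightarrow> J \<subseteq> I \<Longrightarrow> unit_functions J f \<Longrightarrow>
      (\<integral>\<^sup>+\<omega>. ennreal (\<Prod>j\<in>J. f j (\<omega> j)) \<partial>M) = (\<integral>\<^sup>+\<omega>. ennreal (\<Prod>j\<in>J. f j (\<omega> j)) \<partial>N)"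
  shows "M = N"
proof (rule measure_eqI_generator_eq[OF Int_stable_closed_cylinders[of X I]
      closed_cylinders_subset[of X I] _ M N, where A = "\<lambda>_. space (path_space X)"])
  show "emeasure M A = emeasure N A" if cyl: "A \<in> closed_cylinders X I" for A
  proof -
    obtain J F where J: "finite J" "J \<subseteq> I" "\<forall>j\<in>J. closed (F j)" and A: "A = cylinder X J F"
      using cyl by (rule closed_cylindersE)
    have "(\<integral>\<^sup>+\<omega>. ennreal (\<Prod>j\<in>J. bump (F j) m (\<omega> j)) \<partial>M) =
        (\<integral>\<^sup>+\<omega>. ennreal (\<Prod>j\<in>J. bump (F j) m (\<omega> j)) \<partial>N)" for m
      using eq[OF J(1,2) unit_functions_bump[of J F m]] .
    note * = this
    have "(\<lambda>m. \<integral>\<^sup>+\<omega>. ennreal (\<Prod>j\<in>J. bump (F j) m (\<omega> j)) \<partial>N) \<longlonglongrightarrow> emeasure M (cylinder X J F)"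
      using nn_integral_prod_bump_tendsto[OF fin(1) M I J] unfolding * .
    then show ?thesis
      using nn_integral_prod_bump_tendsto[OF fin(2) N I J] unfolding A by (rule LIMSEQ_unique)
  qed
  show "emeasure M (space (path_space X)) \<noteq> \<infinity>"
    using finite_measure.emeasure_finite[OF fin(1)] by simp
qed (auto simp: space_in_closed_cylinders)

section \<open>Shifts and the Markov property at fixed times\<close>

lemma shift_in_path_space:
  assumes "\<omega> \<in> space (path_space X)" "0 \<le> s"
  shows "shift s \<omega> \<in> space (path_space X)"
proof -
  have "continuous_on {0..} (\<lambda>t. \<omega> (s + t))"
    by (rule continuous_on_compose2[OF path_continuous[OF assms(1)]]) (use assms(2) in \<open>auto intro!: continuous_intros\<close>)
  then have "continuous_on {0..} (shift s \<omega>)"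
    by (rule continuous_on_eq) (auto simp: shift_def)
  then show ?thesis
    using assms path_in by (auto simp: space_path_space shift_def)
qed

lemma shift_apply: "0 \<le> t \<Longrightarrow> shift s \<omega> t = \<omega> (s + t)"
  by (simp add: shift_def)

section \<open>Discretised times and random shifts\<close>

text \<open>For nonnegative \<open>r\<close> this is the next multiple of \<open>1/(m+1)\<close>
  strictly above \<open>r\<close>, even when \<open>r\<close> is itself a multiple: floor plus one
  instead of the ceiling. Strictness matches the right-continuous filtration, where at a time
  \<open>c\<close> one can decide whether a stopping time is less than \<open>c\<close>, but not in
  general whether it equals \<open>c\<close>.\<close>

definition discretise :: "nat \<Rightarrow> real \<Rightarrow> real" where
  "discretise m r = (real (nat \<lfloor>real (Suc m) * r\<rfloor>) + 1) / real (Suc m)"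

lemma discretise_nonneg: "0 \<le> discretise m r"
  by (simp add: discretise_def)

lemma discretise_tendsto:
  assumes "0 \<le> r"
  shows "(\<lambda>m. discretise m r) \<longlonglongrightarrow> r"
proof (rule tendsto_sandwich[of "\<lambda>_. r" _ _ "\<lambda>m. r + inverse (real (Suc m))"])
  have *: "real (nat \<lfloor>real (Suc m) * r\<rfloor>) = of_int \<lfloor>real (Suc m) * r\<rfloor>" for m
    using assms by (simp add: of_nat_nat del: of_nat_Suc)
  have "r \<le> discretise m r" for m
    unfolding discretise_def * by (simp add: field_simps del: of_nat_Suc) linarith
  then show "\<forall>\<^sub>F m in sequentially. r \<le> discretise m r" by simp
  have "discretise m r \<le> r + inverse (real (Suc m))" for m
  proof -
    have "of_int \<lfloor>real (Suc m) * r\<rfloor> + 1 \<le> real (Suc m) * r + 1" by linarith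
    then show ?thesis
      unfolding discretise_def * by (simp add: field_simps del: of_nat_Suc)
  qed
  then show "\<forall>\<^sub>F m in sequentially. discretise m r \<le> r + inverse (real (Suc m))" by simp
  show "(\<lambda>m. r + inverse (real (Suc m))) \<longlonglongrightarrow> r"
    using tendsto_add[OF tendsto_const[of r] LIMSEQ_inverse_real_of_nat] by simp
qed simp

lemma path_discretise_tendsto:
  assumes "\<omega> \<in> space (path_space X)" "0 \<le> r" "0 \<le> t"
  shows "(\<lambda>m. \<omega> (discretise m r + t)) \<longlonglongrightarrow> \<omega> (r + t)"
  by (rule continuous_on_tendsto_compose[OF path_continuous[OF assms(1)]])
    (use assms discretise_nonneg in \<open>auto intro!: tendsto_intros discretise_tendsto add_nonneg_nonneg\<close>)

text \<open>After discretisation the random time has countably many values, and on each of them the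
  map is an ordinary evaluation. Continuity of paths carries measurability to the limit.\<close>

lemma measurable_random_eval:
  assumes r: "r \<in> borel_measurable (path_space X)" "\<And>\<omega>. 0 \<le> r \<omega>" and t: "0 \<le> t"
  shows "(\<lambda>\<omega>. \<omega> (r \<omega> + t)) \<in> path_space X \<rightarrow>\<^sub>M restrict_space borel X"
proof (rule measurable_restrict_space2)
  show "(\<lambda>\<omega>. \<omega> (r \<omega> + t)) \<in> space (path_space X) \<rightarrow> X"
    using r(2) t by (auto intro!: path_in add_nonneg_nonneg)
  show "(\<lambda>\<omega>. \<omega> (r \<omega> + t)) \<in> borel_measurable (path_space X)"
  proof (rule borel_measurable_LIMSEQ_metric)
    show "(\<lambda>m. \<omega> (discretise m (r \<omega>) + t)) \<longlonglongrightarrow> \<omega> (r \<omega> + t)" if "\<omega> \<in> space (path_space X)" for \<omega>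
      using that r(2) t by (rule path_discretise_tendsto)
    show "(\<lambda>\<omega>. \<omega> (discretise m (r \<omega>) + t)) \<in> borel_measurable (path_space X)" for m
      unfolding discretise_def
    proof (rule measurable_compose_countable[where f = "\<lambda>k \<omega>. \<omega> ((real k + 1) / real (Suc m) + t)"
          and g = "\<lambda>\<omega>. nat \<lfloor>real (Suc m) * r \<omega>\<rfloor>"])
      show "(\<lambda>\<omega>. \<omega> ((real k + 1) / real (Suc m) + t)) \<in> borel_measurable (path_space X)" for k
        using t by (intro measurable_path_eval_borel) simp
      show "(\<lambda>\<omega>. nat \<lfloor>real (Suc m) * r \<omega>\<rfloor>) \<in> path_space X \<rightarrow>\<^sub>M count_space UNIV"
        using r(1) by measurable
    qed
  qed
qed

lemma measurable_random_shift:
  assumes r: "r \<in> borel_measurable (path_space X)" "\<And>\<omega>. 0 \<le> r \<omega>"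
  shows "(\<lambda>\<omega>. shift (r \<omega>) \<omega>) \<in> path_space X \<rightarrow>\<^sub>M path_space X"
proof (rule measurable_path_spaceI)
  show "(\<lambda>\<omega>. shift (r \<omega>) \<omega>) \<in> space (path_space X) \<rightarrow> space (path_space X)"
    using r(2) by (auto intro: shift_in_path_space)
  show "(\<lambda>\<omega>. shift (r \<omega>) \<omega> t) \<in> borel_measurable (path_space X)" if "0 \<le> t" for t
    using measurable_random_eval[OF r that] unfolding measurable_restrict_space2_iff by (simp add: shift_apply that)
qed

lemma measurable_shift: "0 \<le> s \<Longrightarrow> shift s \<in> path_space X \<rightarrow>\<^sub>M path_space X"
  using measurable_random_shift[of "\<lambda>_. s" X] by simp

section \<open>Filtrations and the Markov property at constant times\<close>

lemma subalgebra_natural_filtration: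
  "sets M = sets (path_space X) \<Longrightarrow> subalgebra M (natural_filtration X s)"
  using natural_filtration_subset[of X s] sets_eq_imp_space_eq[of M "path_space X"]
  by (simp add: subalgebra_def space_natural_filtration)

lemma path_filtration_imp_natural_filtration:
  assumes "A \<in> sets (path_filtration X t)" "t < ennreal s"
  shows "A \<in> sets (natural_filtration X s)"
proof -
  let ?G = "{A \<in> sets (path_space X). \<forall>s. t < ennreal s \<longrightarrow> A \<in> sets (natural_filtration X s)}"
  have "?G \<subseteq> Pow (space (path_space X))"
    using sets.sets_into_space by fastforce
  then have "sets (path_filtration X t) = sigma_sets (space (path_space X)) ?G"
    unfolding path_filtration_def by (rule sets_measure_of)
  also have "\<dots> \<subseteq> sets (natural_filtration X s)"
    using sets.sigma_sets_subset[of ?G "natural_filtration X s"] assms(2)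
    by (auto simp: space_natural_filtration)
  finally show ?thesis using assms(1) by blast
qed

lemma path_filtration_subset: "sets (path_filtration X t) \<subseteq> sets (path_space X)"
proof -
  let ?G = "{A \<in> sets (path_space X). \<forall>s. t < ennreal s \<longrightarrow> A \<in> sets (natural_filtration X s)}"
  have "?G \<subseteq> Pow (space (path_space X))"
    using sets.sets_into_space by fastforce
  then have "sets (path_filtration X t) = sigma_sets (space (path_space X)) ?G"
    unfolding path_filtration_def by (rule sets_measure_of)
  also have "\<dots> \<subseteq> sets (path_space X)"
    by (rule sets.sigma_sets_subset) auto
  finally show ?thesis .
qed

lemma natural_filtration_imp_path_filtration:
  assumes "A \<in> sets (natural_filtration X s)" "0 \<le> s" "ennreal s \<le> t"
  shows "A \<in> sets (path_filtration X t)"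
proof -
  have "s \<le> s'" if "t < ennreal s'" for s'
    using that assms(2,3) by (metis ennreal_leI le_less_trans less_le_not_le nle_le)
  then have "A \<in> {A \<in> sets (path_space X). \<forall>s. t < ennreal s \<longrightarrow> A \<in> sets (natural_filtration X s)}"
    using assms(1) natural_filtration_subset natural_filtration_mono by blast
  then show ?thesis
    unfolding path_filtration_def by (rule in_measure_of[rotated]) (use sets.sets_into_space in fastforce)
qed

lemma kernel_at_time_measurable:
  assumes "P \<in> restrict_space borel X \<rightarrow>\<^sub>M prob_algebra (path_space X)"
    and "f \<in> M \<rightarrow>\<^sub>M restrict_space borel X"
  shows "(\<lambda>\<omega>. P (f \<omega>)) \<in> M \<rightarrow>\<^sub>M subprob_algebra (path_space X)"
  by (rule measurable_compose[OF assms(2) measurable_prob_algebraD[OF assms(1)]])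

lemma prob_algebraD:
  assumes "M \<in> space (prob_algebra N)"
  shows "prob_space M" "sets M = sets N" "space M = space N" "space M \<noteq> {}"
  using assms prob_space.not_empty by (auto simp: space_prob_algebra dest: sets_eq_imp_space_eq)

text \<open>This is the strong Markov property for the constant stopping time \<open>s\<close>. As
  an equality of measures it can be integrated against any functional by the rules for image
  measures and kernels, without a new induction over measurable functions.\<close>

lemma strong_markov_fixed_time_measure:
  assumes P: "strong_markov_family X P" and x: "x \<in> X" and s: "0 \<le> s"
    and A: "A \<in> sets (natural_filtration X s)"
  shows "distr (density (P x) (indicator A)) (path_space X) (shift s) =
    density (P x) (indicator A) \<bind> (\<lambda>\<omega>. P (\<omega> s))"
proof -
  have ker: "P \<in> restrict_space borel X \<rightarrow>\<^sub>M prob_algebra (path_space X)"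
    using P by (simp add: strong_markov_family_def)
  then have "P x \<in> space (prob_algebra (path_space X))"
    using x by (auto dest: measurable_space simp: space_restrict_space)
  note Px = prob_algebraD[OF this]
  note [measurable_cong] = Px(2)
  have A': "A \<in> sets (path_space X)"
    using A natural_filtration_subset by blast
  have [measurable]: "A \<in> sets (P x)"
    using A' Px by simp
  have [measurable]: "shift s \<in> path_space X \<rightarrow>\<^sub>M path_space X"
    using s by (rule measurable_shift)
  have ker_s: "(\<lambda>\<omega>. P (\<omega> s)) \<in> path_space X \<rightarrow>\<^sub>M subprob_algebra (path_space X)"
    by (rule kernel_at_time_measurable[OF ker measurable_path_eval[OF s]])
  then have ker_sA: "(\<lambda>\<omega>. P (\<omega> s)) \<in> density (P x) (indicator A) \<rightarrow>\<^sub>M subprob_algebra (path_space X)"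
    using Px(2) measurable_cong_sets by (metis sets_density)
  have neA: "space (density (P x) (indicator A)) \<noteq> {}"
    using Px by simp
  have eq: "emeasure (P x) {\<omega> \<in> A. shift s \<omega> \<in> C} = (\<integral>\<^sup>+\<omega>. emeasure (P (\<omega> s)) C * indicator A \<omega> \<partial>P x)"
    if C: "C \<in> sets (path_space X)" for C
  proof -
    interpret filtration "space (path_space X)" "path_filtration X" by (rule filtration_path_filtration)
    \<comment> \<open>For the constant time \<open>s\<close> the event to be tested at time
      \<open>t\<close> is empty before \<open>s\<close> and equal to \<open>A\<close> from
      \<open>s\<close> on.\<close>
    have "A \<in> sets (pre_sigma (\<lambda>_. ennreal s))"
    proof (rule sets_pre_sigmaI[OF stopping_time_const])
      fix t show "{\<omega> \<in> A. ennreal s \<le> t} \<in> sets (path_filtration X t)"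
        using natural_filtration_imp_path_filtration[OF A s] by (cases "ennreal s \<le> t") auto
    qed
    then have "emeasure (P x) {\<omega> \<in> A. ennreal s < \<infinity> \<and> shift (enn2real (ennreal s)) \<omega> \<in> C} =
       (\<integral>\<^sup>+\<omega>. emeasure (P (\<omega> (enn2real (ennreal s)))) C * indicator {\<omega> \<in> A. ennreal s < \<infinity>} \<omega> \<partial>P x)"
      using P x C stopping_time_const unfolding strong_markov_family_def by blast
    then show ?thesis
      using s by simp
  qed
  show ?thesis
  proof (rule measure_eqI)
    show sets: "sets (distr (density (P x) (indicator A)) (path_space X) (shift s)) =
        sets (density (P x) (indicator A) \<bind> (\<lambda>\<omega>. P (\<omega> s)))"
      using sets_bind[of "density (P x) (indicator A)" "\<lambda>\<omega>. P (\<omega> s)" "path_space X", OF _ neA]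
        sets_kernel[OF ker_sA] by simp
    fix C assume "C \<in> sets (distr (density (P x) (indicator A)) (path_space X) (shift s))"
    then have C[measurable]: "C \<in> sets (path_space X)" by simp
    have "emeasure (distr (density (P x) (indicator A)) (path_space X) (shift s)) C =
       (\<integral>\<^sup>+\<omega>. indicator A \<omega> * indicator (shift s -` C \<inter> space (P x)) \<omega> \<partial>P x)"
      by (simp add: emeasure_distr emeasure_density)
    also have "\<dots> = (\<integral>\<^sup>+\<omega>. indicator {\<omega> \<in> A. shift s \<omega> \<in> C} \<omega> \<partial>P x)"
      by (intro nn_integral_cong) (auto simp: indicator_def)
    also have "\<dots> = emeasure (P x) {\<omega> \<in> A. shift s \<omega> \<in> C}"
    proof (rule nn_integral_indicator)
      have "{\<omega> \<in> A. shift s \<omega> \<in> C} = A \<inter> (shift s -` C \<inter> space (P x))"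
        using sets.sets_into_space[OF A'] Px(3) by auto
      also have "\<dots> \<in> sets (P x)" by measurable
      finally show "{\<omega> \<in> A. shift s \<omega> \<in> C} \<in> sets (P x)" .
    qed
    also have "\<dots> = (\<integral>\<^sup>+\<omega>. emeasure (P (\<omega> s)) C * indicator A \<omega> \<partial>P x)"
      by (rule eq[OF C])
    also have "\<dots> = (\<integral>\<^sup>+\<omega>. emeasure (P (\<omega> s)) C \<partial>density (P x) (indicator A))"
      using measurable_emeasure_kernel[OF ker_s C]
      by (subst nn_integral_density) (auto simp: mult.commute measurable_cong_sets[OF Px(2) refl])
    also have "\<dots> = emeasure (density (P x) (indicator A) \<bind> (\<lambda>\<omega>. P (\<omega> s))) C"
      by (rule emeasure_bind[OF neA ker_sA C, symmetric])
    finally show "emeasure (distr (density (P x) (indicator A)) (path_space X) (shift s)) C =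
      emeasure (density (P x) (indicator A) \<bind> (\<lambda>\<omega>. P (\<omega> s))) C" .
  qed
qed

text \<open>The hypothesis says that the measures with densities \<open>h1\<close> and
  \<open>h2\<close> coincide on \<open>F\<close>. Equal measures integrate every
  \<open>F\<close>-measurable weight equally, so indicators may be replaced by \<open>g\<close>
  without integrability conditions.\<close>

lemma nn_integral_subalgebra_eqI:
  assumes F: "subalgebra M F" and [measurable]: "h1 \<in> borel_measurable M" "h2 \<in> borel_measurable M"
    and eq: "\<And>A. A \<in> sets F \<Longrightarrow> (\<integral>\<^sup>+x. h1 x * indicator A x \<partial>M) = (\<integral>\<^sup>+x. h2 x * indicator A x \<partial>M)"
    and g: "g \<in> borel_measurable F"
  shows "(\<integral>\<^sup>+x. h1 x * g x \<partial>M) = (\<integral>\<^sup>+x. h2 x * g x \<partial>M)"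
proof -
  have sub: "subalgebra (density M h) F" for h
    using F by (simp add: subalgebra_def)
  have gM[measurable]: "g \<in> borel_measurable M"
    using g by (rule measurable_from_subalg[OF F])
  have "restr_to_subalg (density M h1) F = restr_to_subalg (density M h2) F"
  proof (rule measure_eqI)
    fix A assume "A \<in> sets (restr_to_subalg (density M h1) F)"
    then have A: "A \<in> sets F" by (simp add: sets_restr_to_subalg[OF sub])
    then have "A \<in> sets M" using F by (auto simp: subalgebra_def)
    then show "emeasure (restr_to_subalg (density M h1) F) A = emeasure (restr_to_subalg (density M h2) F) A"
      using A eq[OF A] by (simp add: emeasure_restr_to_subalg[OF sub] emeasure_density)
  qed (simp add: sets_restr_to_subalg[OF sub])
  then have "(\<integral>\<^sup>+x. g x \<partial>density M h1) = (\<integral>\<^sup>+x. g x \<partial>density M h2)"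
    using nn_integral_subalgebra2[OF sub g] by metis
  then show ?thesis
    by (simp add: nn_integral_density)
qed

lemma strong_markov_fixed_time:
  assumes P: "strong_markov_family X P" and x: "x \<in> X" and s: "0 \<le> s"
    and \<Phi>: "\<Phi> \<in> borel_measurable (path_space X)" and \<Psi>: "\<Psi> \<in> borel_measurable (natural_filtration X s)"
  shows "(\<integral>\<^sup>+\<omega>. \<Phi> (shift s \<omega>) * \<Psi> \<omega> \<partial>P x) = (\<integral>\<^sup>+\<omega>. (\<integral>\<^sup>+\<omega>'. \<Phi> \<omega>' \<partial>P (\<omega> s)) * \<Psi> \<omega> \<partial>P x)"
proof -
  have ker: "P \<in> restrict_space borel X \<rightarrow>\<^sub>M prob_algebra (path_space X)"
    using P by (simp add: strong_markov_family_def)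
  then have "P x \<in> space (prob_algebra (path_space X))"
    using x by (auto dest: measurable_space simp: space_restrict_space)
  note Px = prob_algebraD[OF this]
  note [measurable_cong] = Px(2)
  note [measurable] = \<Phi>
  have [measurable]: "shift s \<in> path_space X \<rightarrow>\<^sub>M path_space X"
    using s by (rule measurable_shift)
  have ker_s: "(\<lambda>\<omega>. P (\<omega> s)) \<in> path_space X \<rightarrow>\<^sub>M subprob_algebra (path_space X)"
    by (rule kernel_at_time_measurable[OF ker measurable_path_eval[OF s]])
  have [measurable]: "(\<lambda>\<omega>. \<integral>\<^sup>+\<omega>'. \<Phi> \<omega>' \<partial>P (\<omega> s)) \<in> borel_measurable (path_space X)"
    by (rule measurable_compose[OF ker_s nn_integral_measurable_subprob_algebra[OF \<Phi>]])
  show ?thesis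
  proof (rule nn_integral_subalgebra_eqI[OF subalgebra_natural_filtration[OF Px(2)] _ _ _ \<Psi>])
    fix A assume A: "A \<in> sets (natural_filtration X s)"
    then have [measurable]: "A \<in> sets (path_space X)"
      using natural_filtration_subset by blast
    have ker_sA: "(\<lambda>\<omega>. P (\<omega> s)) \<in> density (P x) (indicator A) \<rightarrow>\<^sub>M subprob_algebra (path_space X)"
      using ker_s Px(2) measurable_cong_sets by (metis sets_density)
    have "(\<integral>\<^sup>+\<omega>. \<Phi> (shift s \<omega>) * indicator A \<omega> \<partial>P x) = (\<integral>\<^sup>+\<omega>. \<Phi> \<omega> \<partial>distr (density (P x) (indicator A)) (path_space X) (shift s))"
      by (simp add: nn_integral_distr nn_integral_density mult.commute)
    also have "\<dots> = (\<integral>\<^sup>+\<omega>. (\<integral>\<^sup>+\<omega>'. \<Phi> \<omega>' \<partial>P (\<omega> s)) \<partial>density (P x) (indicator A))"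
      unfolding strong_markov_fixed_time_measure[OF P x s A] by (rule nn_integral_bind[OF \<Phi> ker_sA])
    also have "\<dots> = (\<integral>\<^sup>+\<omega>. (\<integral>\<^sup>+\<omega>'. \<Phi> \<omega>' \<partial>P (\<omega> s)) * indicator A \<omega> \<partial>P x)"
      by (simp add: nn_integral_density mult.commute)
    finally show "(\<integral>\<^sup>+\<omega>. \<Phi> (shift s \<omega>) * indicator A \<omega> \<partial>P x) =
      (\<integral>\<^sup>+\<omega>. (\<integral>\<^sup>+\<omega>'. \<Phi> \<omega>' \<partial>P (\<omega> s)) * indicator A \<omega> \<partial>P x)" .
  qed measurable
qed

section \<open>From cylinder functionals to the strong Markov property\<close>

lemma unit_functions_continuous: "unit_functions K f \<Longrightarrow> k \<in> K \<Longrightarrow> continuous_on A (f k)"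
  unfolding unit_functions_def using continuous_on_subset by blast

lemma unit_functions_shifted_prod:
  assumes "unit_functions K f"
  shows "0 \<le> (\<Prod>k\<in>K. f k (\<omega> (s + k)))" "(\<Prod>k\<in>K. f k (\<omega> (s + k))) \<le> 1"
  using assms by (auto simp: unit_functions_def intro!: prod_nonneg prod_le_1)

lemma measurable_shifted_functional:
  assumes "K \<subseteq> {0..}" "unit_functions K f" "0 \<le> s"
  shows "(\<lambda>\<omega>. \<Prod>k\<in>K. f k (\<omega> (s + k))) \<in> borel_measurable (path_space X)"
  using assms by (intro borel_measurable_prod measurable_compose[OF measurable_path_eval
      borel_measurable_continuous_on_restrict] unit_functions_continuous) auto

lemma measurable_cylinder_functional:
  assumes "J \<subseteq> {0..}" "unit_functions J f"
  shows "(\<lambda>\<omega>. \<Prod>j\<in>J. f j (\<omega> j)) \<in> borel_measurable (path_space X)"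
  using measurable_shifted_functional[OF assms order_refl] by simp

text \<open>This is all that the construction of the strong Markov property uses about
  \<open>B\<close>; the approximating graphs no longer appear. The assumption \<open>markov\<close>
  concerns constant times and product functionals only, and \<open>cont\<close> is a Feller property
  for these functionals.\<close>

locale cylinder_markov =
  fixes X :: "'a::metric_space set" and B :: "'a \<Rightarrow> (real \<Rightarrow> 'a) measure"
  assumes law: "x \<in> X \<Longrightarrow> B x \<in> space (prob_algebra (path_space X))"
    and start: "x \<in> X \<Longrightarrow> AE \<omega> in B x. \<omega> 0 = x"
    and cont: "finite J \<Longrightarrow> J \<subseteq> {0..} \<Longrightarrow> unit_functions J f \<Longrightarrow>
      continuous_on X (\<lambda>x. \<integral>\<omega>. (\<Prod>j\<in>J. f j (\<omega> j)) \<partial>B x)"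
    and markov: "x \<in> X \<Longrightarrow> 0 \<le> s \<Longrightarrow> finite J \<Longrightarrow> J \<subseteq> {0..s} \<Longrightarrow> unit_functions J g \<Longrightarrow>
      finite K \<Longrightarrow> K \<subseteq> {0..} \<Longrightarrow> unit_functions K f \<Longrightarrow>
      (\<integral>\<omega>. (\<Prod>j\<in>J. g j (\<omega> j)) * (\<Prod>k\<in>K. f k (\<omega> (s + k))) \<partial>B x) =
      (\<integral>\<omega>. (\<Prod>j\<in>J. g j (\<omega> j)) * (\<integral>\<omega>'. (\<Prod>k\<in>K. f k (\<omega>' k)) \<partial>B (\<omega> s)) \<partial>B x)"
begin

lemmas lawD = prob_algebraD[OF law]

lemma nn_integral_cylinder_functional:
  assumes "x \<in> X" "J \<subseteq> {0..}" "unit_functions J f"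
  shows "(\<integral>\<^sup>+\<omega>. ennreal (\<Prod>j\<in>J. f j (\<omega> j)) \<partial>B x) = ennreal (\<integral>\<omega>. (\<Prod>j\<in>J. f j (\<omega> j)) \<partial>B x)"
proof (rule nn_integral_eq_integral)
  interpret prob_space "B x" using assms(1) by (rule lawD)
  show "integrable (B x) (\<lambda>\<omega>. \<Prod>j\<in>J. f j (\<omega> j))"
  proof (rule integrable_const_bound[of _ 1])
    show "(\<lambda>\<omega>. \<Prod>j\<in>J. f j (\<omega> j)) \<in> borel_measurable (B x)"
      using measurable_cylinder_functional[OF assms(2,3)] lawD(2)[OF assms(1)] measurable_cong_sets by blast
  qed (use unit_functions_prod[OF assms(3)] in auto)
qed (use unit_functions_prod[OF assms(3)] in auto)

lemma cylinder_expectation_range: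
  assumes "x \<in> X" "J \<subseteq> {0..}" "unit_functions J f"
  shows "0 \<le> (\<integral>\<omega>. (\<Prod>j\<in>J. f j (\<omega> j)) \<partial>B x)" "(\<integral>\<omega>. (\<Prod>j\<in>J. f j (\<omega> j)) \<partial>B x) \<le> 1"
proof -
  interpret prob_space "B x" using assms(1) by (rule lawD)
  show "0 \<le> (\<integral>\<omega>. (\<Prod>j\<in>J. f j (\<omega> j)) \<partial>B x)"
    using unit_functions_prod[OF assms(3)] by (intro integral_nonneg_AE) auto
  have "(\<integral>\<^sup>+\<omega>. ennreal (\<Prod>j\<in>J. f j (\<omega> j)) \<partial>B x) \<le> (\<integral>\<^sup>+\<omega>. 1 \<partial>B x)"
    using unit_functions_prod[OF assms(3)] by (intro nn_integral_mono) (auto simp: ennreal_le_1)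
  then show "(\<integral>\<omega>. (\<Prod>j\<in>J. f j (\<omega> j)) \<partial>B x) \<le> 1"
    unfolding nn_integral_cylinder_functional[OF assms] by (simp add: emeasure_space_1 ennreal_le_1)
qed

text \<open>The probability of a closed cylinder is a pointwise limit of expectations of bump
  products, which are continuous in \<open>x\<close> by \<open>cont\<close>. Measurability on this
  generator suffices.\<close>

lemma kernel: "B \<in> restrict_space borel X \<rightarrow>\<^sub>M prob_algebra (path_space X)"
proof (rule measurable_prob_algebra_generated[OF sets_path_space Int_stable_closed_cylinders closed_cylinders_subset])
  fix x assume "x \<in> space (restrict_space borel X)"
  then have "x \<in> X" by (simp add: space_restrict_space)
  then show "prob_space (B x)" "sets (B x) = sets (path_space X)"
    by (rule lawD)+
next
  fix A assume "A \<in> closed_cylinders X {0..}"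
  then obtain J F where J: "finite J" "J \<subseteq> {0..}" "\<forall>j\<in>J. closed (F j)" and A: "A = cylinder X J F"
    by (rule closed_cylindersE)
  show "(\<lambda>x. emeasure (B x) A) \<in> borel_measurable (restrict_space borel X)"
    unfolding A
  proof (rule borel_measurable_LIMSEQ_order)
    fix x assume "x \<in> space (restrict_space borel X)"
    then have x: "x \<in> X" by (simp add: space_restrict_space)
    show "(\<lambda>m. ennreal (\<integral>\<omega>. (\<Prod>j\<in>J. bump (F j) m (\<omega> j)) \<partial>B x)) \<longlonglongrightarrow> emeasure (B x) (cylinder X J F)"
      unfolding nn_integral_cylinder_functional[OF x J(2) unit_functions_bump, symmetric]
      using lawD[OF x] sets_path_space J
      by (intro nn_integral_prod_bump_tendsto[where I = "{0..}"] prob_space.finite_measure) auto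
  next
    fix m
    show "(\<lambda>x. ennreal (\<integral>\<omega>. (\<Prod>j\<in>J. bump (F j) m (\<omega> j)) \<partial>B x)) \<in> borel_measurable (restrict_space borel X)"
      using cont[OF J(1,2) unit_functions_bump]
      by (intro measurable_compose[OF borel_measurable_continuous_on_restrict measurable_ennreal]) auto
  qed
qed

text \<open>The two integrands are viewed as densities on the past up to \<open>s\<close>. The
  assumption \<open>markov\<close> says that the resulting finite measures agree on product
  functionals of the past, hence they agree on every event of the past.\<close>

lemma markov_natural_filtration:
  assumes x: "x \<in> X" and s: "0 \<le> s" and K: "finite K" "K \<subseteq> {0..}" "unit_functions K f"
    and A: "A \<in> sets (natural_filtration X s)"
  shows "(\<integral>\<^sup>+\<omega>. ennreal (\<Prod>k\<in>K. f k (\<omega> (s + k))) * indicator A \<omega> \<partial>B x) =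
    (\<integral>\<^sup>+\<omega>. ennreal (\<integral>\<omega>'. (\<Prod>k\<in>K. f k (\<omega>' k)) \<partial>B (\<omega> s)) * indicator A \<omega> \<partial>B x)"
proof -
  let ?\<Phi> = "\<lambda>\<omega>. \<Prod>k\<in>K. f k (\<omega> (s + k))"
  let ?u = "\<lambda>x. \<integral>\<omega>'. (\<Prod>k\<in>K. f k (\<omega>' k)) \<partial>B x"
  let ?F = "natural_filtration X s"
  interpret prob_space "B x" using x by (rule lawD)
  note [measurable_cong] = lawD(2)[OF x]
  have sp: "space (B x) = space (path_space X)"
    using lawD(3)[OF x] .
  have \<Phi>_range: "0 \<le> ?\<Phi> \<omega>" "?\<Phi> \<omega> \<le> 1" for \<omega>
    by (rule unit_functions_shifted_prod[OF K(3)])+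
  have \<Phi>_meas[measurable]: "?\<Phi> \<in> borel_measurable (path_space X)"
    using K(2,3) s by (rule measurable_shifted_functional)
  have "?u \<in> borel_measurable (restrict_space borel X)"
    by (intro borel_measurable_continuous_on_restrict cont K)
  from measurable_compose[OF measurable_path_eval[OF s] this]
  have u_meas[measurable]: "(\<lambda>\<omega>. ?u (\<omega> s)) \<in> borel_measurable (path_space X)" .
  have u_range: "0 \<le> ?u (\<omega> s)" "?u (\<omega> s) \<le> 1" if "\<omega> \<in> space (B x)" for \<omega>
    using cylinder_expectation_range[OF path_in[OF _ s] K(2,3)] that sp by auto
  have sub: "subalgebra (density (B x) h) ?F" for h
    using subalgebra_natural_filtration[of "density (B x) h" X s] lawD(2)[OF x] by simp
  have fin: "finite_measure (density (B x) (\<lambda>\<omega>. ennreal (h \<omega>)))"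
    if [measurable]: "h \<in> borel_measurable (path_space X)" and "\<And>\<omega>. \<omega> \<in> space (B x) \<Longrightarrow> h \<omega> \<le> 1" for h
  proof
    have "emeasure (density (B x) (\<lambda>\<omega>. ennreal (h \<omega>))) (space (B x)) = (\<integral>\<^sup>+\<omega>. ennreal (h \<omega>) * indicator (space (B x)) \<omega> \<partial>B x)"
      by (rule emeasure_density) auto
    also have "\<dots> \<le> (\<integral>\<^sup>+\<omega>. 1 \<partial>B x)"
      using that by (intro nn_integral_mono) (auto simp: indicator_def ennreal_le_1)
    finally show "emeasure (density (B x) (\<lambda>\<omega>. ennreal (h \<omega>))) (space (density (B x) (\<lambda>\<omega>. ennreal (h \<omega>)))) \<noteq> \<infinity>"
      by (auto simp: emeasure_space_1 top_unique)
  qed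
  have "restr_to_subalg (density (B x) ?\<Phi>) ?F = restr_to_subalg (density (B x) (\<lambda>\<omega>. ?u (\<omega> s))) ?F"
  proof (rule measure_eqI_cylinder_functionals[of _ _ X "{0..s}"])
    show "finite_measure (restr_to_subalg (density (B x) ?\<Phi>) ?F)"
      "finite_measure (restr_to_subalg (density (B x) (\<lambda>\<omega>. ?u (\<omega> s))) ?F)"
      using \<Phi>_range u_range by (auto intro!: finite_measure_restr_to_subalg[OF sub] fin)
    fix J g assume J: "finite J" "J \<subseteq> {0..s}" "unit_functions J (g :: real \<Rightarrow> 'a \<Rightarrow> real)"
    let ?\<Psi> = "\<lambda>\<omega>. \<Prod>j\<in>J. g j (\<omega> j)"
    have \<Psi>F: "?\<Psi> \<in> borel_measurable ?F"
    proof (rule measurable_prod_functional[OF J(3)])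
      show "(\<lambda>\<omega>. \<omega> j) \<in> ?F \<rightarrow>\<^sub>M borel" if "j \<in> J" for j
        by (rule eval_measurable_sigma_cylinders[OF sets_natural_filtration]) (use that J(2) in auto)
    qed
    then have \<Psi>F': "(\<lambda>\<omega>. ennreal (?\<Psi> \<omega>)) \<in> borel_measurable ?F" by measurable
    have \<Psi>[measurable]: "?\<Psi> \<in> borel_measurable (path_space X)"
      using J(2,3) by (intro measurable_cylinder_functional) auto
    note \<Psi>_range = unit_functions_prod[OF J(3)]
    \<comment> \<open>Stated for a general density, so that it brings both sides to the form in
      which \<open>markov\<close> applies.\<close>
    have red: "(\<integral>\<^sup>+\<omega>. ennreal (?\<Psi> \<omega>) \<partial>restr_to_subalg (density (B x) (\<lambda>\<omega>. ennreal (h \<omega>))) ?F) = ennreal (\<integral>\<omega>. ?\<Psi> \<omega> * h \<omega> \<partial>B x)"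
      if [measurable]: "h \<in> borel_measurable (path_space X)"
        and h: "\<And>\<omega>. \<omega> \<in> space (B x) \<Longrightarrow> 0 \<le> h \<omega>" "\<And>\<omega>. \<omega> \<in> space (B x) \<Longrightarrow> h \<omega> \<le> 1" for h
    proof -
      have "(\<integral>\<^sup>+\<omega>. ennreal (?\<Psi> \<omega>) \<partial>restr_to_subalg (density (B x) (\<lambda>\<omega>. ennreal (h \<omega>))) ?F) =
          (\<integral>\<^sup>+\<omega>. ennreal (h \<omega>) * ennreal (?\<Psi> \<omega>) \<partial>B x)"
        unfolding nn_integral_subalgebra2[OF sub \<Psi>F'] by (rule nn_integral_density) auto
      also have "\<dots> = (\<integral>\<^sup>+\<omega>. ennreal (?\<Psi> \<omega> * h \<omega>) \<partial>B x)"
        using h \<Psi>_range by (intro nn_integral_cong) (simp add: ennreal_mult mult.commute)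
      also have "\<dots> = ennreal (\<integral>\<omega>. ?\<Psi> \<omega> * h \<omega> \<partial>B x)"
      proof (rule nn_integral_eq_integral)
        show "integrable (B x) (\<lambda>\<omega>. ?\<Psi> \<omega> * h \<omega>)"
          using h \<Psi>_range by (intro integrable_const_bound[of _ 1]) (auto simp: abs_mult intro!: mult_le_one)
      qed (use h \<Psi>_range in auto)
      finally show ?thesis .
    qed
    show "(\<integral>\<^sup>+\<omega>. ennreal (?\<Psi> \<omega>) \<partial>restr_to_subalg (density (B x) ?\<Phi>) ?F) =
        (\<integral>\<^sup>+\<omega>. ennreal (?\<Psi> \<omega>) \<partial>restr_to_subalg (density (B x) (\<lambda>\<omega>. ?u (\<omega> s))) ?F)"
    proof (rule trans[OF red trans[OF _ red[symmetric]]])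
      show "ennreal (\<integral>\<omega>. ?\<Psi> \<omega> * ?\<Phi> \<omega> \<partial>B x) = ennreal (\<integral>\<omega>. ?\<Psi> \<omega> * ?u (\<omega> s) \<partial>B x)"
        using markov[OF x s J K] by (rule arg_cong)
    qed (rule \<Phi>_meas u_meas \<Phi>_range u_range, assumption?)+
  qed (auto simp: sets_restr_to_subalg[OF sub] sets_natural_filtration)
  then have "emeasure (density (B x) ?\<Phi>) A = emeasure (density (B x) (\<lambda>\<omega>. ?u (\<omega> s))) A"
    unfolding emeasure_restr_to_subalg[OF sub A, symmetric] by (rule arg_cong)
  moreover have "A \<in> sets (B x)"
    using A natural_filtration_subset lawD(2)[OF x] by blast
  ultimately show ?thesis
    by (simp add: emeasure_density)
qed

section \<open>From constant times to stopping times\<close>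

text \<open>Strict inequality absorbs the right-continuity of the filtration: an event decided
  immediately after a time below \<open>c\<close> is decided at \<open>c\<close>, and the strict
  event is a countable union of such events.\<close>

lemma stopping_time_less_natural:
  assumes T: "stopping_time (path_filtration X) T"
    and A: "A \<in> sets (filtration.pre_sigma (space (path_space X)) (path_filtration X) T)"
  shows "{\<omega> \<in> A. T \<omega> < ennreal c} \<in> sets (natural_filtration X c)"
proof (cases "0 < c")
  case True
  \<comment> \<open>For small \<open>n\<close> the level may be negative; \<open>ennreal\<close>
    then turns it into 0, which is still below \<open>c\<close>.\<close>
  have "{\<omega> \<in> A. T \<omega> < ennreal c} = (\<Union>n. {\<omega> \<in> A. T \<omega> \<le> ennreal (c - inverse (real (Suc n)))})"
  proof safe
    fix \<omega> assume \<omega>: "\<omega> \<in> A" "T \<omega> < ennreal c"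
    then obtain t where t: "T \<omega> = ennreal t" "0 \<le> t"
      by (cases "T \<omega>") auto
    then have "t < c"
      using \<omega>(2) by (simp add: ennreal_less_iff)
    then obtain n where "inverse (real (Suc n)) < c - t"
      using reals_Archimedean[of "c - t"] by auto
    then show "\<omega> \<in> (\<Union>n. {\<omega> \<in> A. T \<omega> \<le> ennreal (c - inverse (real (Suc n)))})"
      using \<omega>(1) t by (auto intro!: exI[of _ n] ennreal_leI)
  next
    fix \<omega> n assume "T \<omega> \<le> ennreal (c - inverse (real (Suc n)))"
    also have "\<dots> < ennreal c"
      using True by (intro ennreal_lessI) auto
    finally show "T \<omega> < ennreal c" .
  qed
  also have "\<dots> \<in> sets (natural_filtration X c)"
  proof (intro sets.countable_UN image_subsetI)
    fix n
    have "ennreal (c - inverse (real (Suc n))) < ennreal c"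
      using True by (intro ennreal_lessI) auto
    with filtration.sets_pre_sigmaD[OF filtration_path_filtration T A]
    show "{\<omega> \<in> A. T \<omega> \<le> ennreal (c - inverse (real (Suc n)))} \<in> sets (natural_filtration X c)"
      by (rule path_filtration_imp_natural_filtration)
  qed
  finally show ?thesis .
next
  case False
  then show ?thesis by (simp add: ennreal_neg)
qed

text \<open>The discretised time is constant on each piece \<open>D k\<close>, and
  \<open>D k\<close> belongs to the past of that constant value. The Markov property at constant
  times applies to every piece, and the pieces are summed.\<close>

lemma markov_discretised:
  assumes x: "x \<in> X" and K: "finite K" "K \<subseteq> {0..}" "unit_functions K f"
    and T: "stopping_time (path_filtration X) T"
    and A: "A \<in> sets (filtration.pre_sigma (space (path_space X)) (path_filtration X) T)"
  shows "(\<integral>\<^sup>+\<omega>. ennreal (\<Prod>k\<in>K. f k (\<omega> (discretise m (enn2real (T \<omega>)) + k))) * indicator {\<omega> \<in> A. T \<omega> < \<infinity>} \<omega> \<partial>B x) =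
    (\<integral>\<^sup>+\<omega>. ennreal (\<integral>\<omega>'. (\<Prod>k\<in>K. f k (\<omega>' k)) \<partial>B (\<omega> (discretise m (enn2real (T \<omega>))))) * indicator {\<omega> \<in> A. T \<omega> < \<infinity>} \<omega> \<partial>B x)"
proof -
  define c where "c k = real k / real (Suc m)" for k
  \<comment> \<open>On \<open>D k\<close> the stopping time lies in the half-open interval from
    \<open>c k\<close> to \<open>c (Suc k)\<close>. The form as a difference of two strict events
    puts it in the natural filtration at the right endpoint, the value of the discretised
    time.\<close>
  define D where "D k = {\<omega> \<in> A. T \<omega> < ennreal (c (Suc k))} - {\<omega> \<in> A. T \<omega> < ennreal (c k)}" for k
  have cpos: "0 \<le> c k" for k by (simp add: c_def)
  have D: "D k \<in> sets (natural_filtration X (c (Suc k)))" for k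
  proof -
    have "c k \<le> c (Suc k)" by (simp add: c_def divide_right_mono)
    then show ?thesis
      unfolding D_def using stopping_time_less_natural[OF T A] natural_filtration_mono by blast
  qed
  have D': "D k \<in> sets (B x)" for k
    using D natural_filtration_subset lawD(2)[OF x] by blast
  have single: "\<omega> \<in> D k \<longleftrightarrow> \<omega> \<in> A \<and> T \<omega> < \<infinity> \<and> k = nat \<lfloor>real (Suc m) * enn2real (T \<omega>)\<rfloor>" for \<omega> k
  proof (cases "T \<omega>")
    case (real t)
    have "\<omega> \<in> D k \<longleftrightarrow> \<omega> \<in> A \<and> c k \<le> t \<and> t < c (Suc k)"
      using real cpos by (auto simp: D_def ennreal_less_iff not_less)
    also have "c k \<le> t \<and> t < c (Suc k) \<longleftrightarrow> real k \<le> real (Suc m) * t \<and> real (Suc m) * t < real k + 1"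
      by (auto simp: c_def field_simps)
    also have "\<dots> \<longleftrightarrow> \<lfloor>real (Suc m) * t\<rfloor> = int k"
      by (auto simp: floor_eq_iff)
    also have "\<dots> \<longleftrightarrow> k = nat \<lfloor>real (Suc m) * t\<rfloor>"
      using real by (auto simp: nat_eq_iff2 simp del: of_nat_Suc)
    finally show ?thesis using real by simp
  next
    case top
    then show ?thesis by (simp add: D_def)
  qed
  \<comment> \<open>The time is kept as an argument of \<open>h\<close> because the same
    decomposition is applied to the integrands of both sides.\<close>
  have decomp: "(\<integral>\<^sup>+\<omega>. h (discretise m (enn2real (T \<omega>))) \<omega> * indicator {\<omega> \<in> A. T \<omega> < \<infinity>} \<omega> \<partial>B x) =
      (\<Sum>k. \<integral>\<^sup>+\<omega>. h (c (Suc k)) \<omega> * indicator (D k) \<omega> \<partial>B x)"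
    if meas: "\<And>s. 0 \<le> s \<Longrightarrow> h s \<in> borel_measurable (B x)" for h :: "real \<Rightarrow> (real \<Rightarrow> 'a) \<Rightarrow> ennreal"
  proof -
    have "h (discretise m (enn2real (T \<omega>))) \<omega> * indicator {\<omega> \<in> A. T \<omega> < \<infinity>} \<omega> =
        (\<Sum>k. h (c (Suc k)) \<omega> * indicator (D k) \<omega>)" for \<omega>
    proof (cases "\<omega> \<in> A \<and> T \<omega> < \<infinity>")
      case True
      let ?k = "nat \<lfloor>real (Suc m) * enn2real (T \<omega>)\<rfloor>"
      have "(\<lambda>k. h (c (Suc k)) \<omega> * indicator (D k) \<omega>) = (\<lambda>k. if k = ?k then h (c (Suc k)) \<omega> else 0)"
        using True by (auto simp: single)
      also have "\<dots> sums h (c (Suc ?k)) \<omega>"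
        by (rule sums_single)
      finally have "(\<Sum>k. h (c (Suc k)) \<omega> * indicator (D k) \<omega>) = h (c (Suc ?k)) \<omega>"
        by (rule sums_unique[symmetric])
      moreover have "c (Suc ?k) = discretise m (enn2real (T \<omega>))"
        by (simp add: c_def discretise_def add.commute)
      ultimately show ?thesis using True by simp
    next
      case False
      then have "\<omega> \<notin> D k" for k by (auto simp: single)
      then show ?thesis using False by auto
    qed
    then have "(\<integral>\<^sup>+\<omega>. h (discretise m (enn2real (T \<omega>))) \<omega> * indicator {\<omega> \<in> A. T \<omega> < \<infinity>} \<omega> \<partial>B x) =
      (\<integral>\<^sup>+\<omega>. (\<Sum>k. h (c (Suc k)) \<omega> * indicator (D k) \<omega>) \<partial>B x)"
      by simp
    also have "\<dots> = (\<Sum>k. \<integral>\<^sup>+\<omega>. h (c (Suc k)) \<omega> * indicator (D k) \<omega> \<partial>B x)"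
      using meas cpos D' by (intro nn_integral_suminf) auto
    finally show ?thesis .
  qed
  let ?u = "\<lambda>x. \<integral>\<omega>'. (\<Prod>k\<in>K. f k (\<omega>' k)) \<partial>B x"
  have 1: "(\<lambda>\<omega>. ennreal (\<Prod>k\<in>K. f k (\<omega> (s + k)))) \<in> borel_measurable (B x)" if s: "0 \<le> s" for s
    using measurable_shifted_functional[OF K(2,3) s, of X]
    unfolding measurable_cong_sets[OF lawD(2)[OF x] refl] by measurable
  have 2: "(\<lambda>\<omega>. ennreal (?u (\<omega> s))) \<in> borel_measurable (B x)" if s: "0 \<le> s" for s
  proof -
    have "?u \<in> borel_measurable (restrict_space borel X)"
      by (intro borel_measurable_continuous_on_restrict cont K)
    from measurable_compose[OF measurable_path_eval[OF s] this] show ?thesis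
      unfolding measurable_cong_sets[OF lawD(2)[OF x] refl] by measurable
  qed
  have "(\<Sum>k. \<integral>\<^sup>+\<omega>. ennreal (\<Prod>j\<in>K. f j (\<omega> (c (Suc k) + j))) * indicator (D k) \<omega> \<partial>B x) =
      (\<Sum>k. \<integral>\<^sup>+\<omega>. ennreal (?u (\<omega> (c (Suc k)))) * indicator (D k) \<omega> \<partial>B x)"
    by (intro suminf_cong markov_natural_filtration x cpos K D)
  then show ?thesis
    using decomp[of "\<lambda>s \<omega>. ennreal (\<Prod>k\<in>K. f k (\<omega> (s + k)))", OF 1]
      decomp[of "\<lambda>s \<omega>. ennreal (?u (\<omega> s))", OF 2] by metis
qed

text \<open>Both sides of the discretised identity converge as the mesh tends to 0, dominated by 1.
  The left side needs continuity of paths and of the factors; the right side needs in addition that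
  the expectation depends continuously on the starting point.\<close>

lemma strong_markov_cylinder:
  assumes x: "x \<in> X" and K: "finite K" "K \<subseteq> {0..}" "unit_functions K f"
    and T: "stopping_time (path_filtration X) T"
    and A: "A \<in> sets (filtration.pre_sigma (space (path_space X)) (path_filtration X) T)"
    and Tm: "T \<in> borel_measurable (path_space X)" and A': "A \<in> sets (path_space X)"
  shows "(\<integral>\<^sup>+\<omega>. ennreal (\<Prod>k\<in>K. f k (\<omega> (enn2real (T \<omega>) + k))) * indicator {\<omega> \<in> A. T \<omega> < \<infinity>} \<omega> \<partial>B x) =
    (\<integral>\<^sup>+\<omega>. ennreal (\<integral>\<omega>'. (\<Prod>k\<in>K. f k (\<omega>' k)) \<partial>B (\<omega> (enn2real (T \<omega>)))) * indicator {\<omega> \<in> A. T \<omega> < \<infinity>} \<omega> \<partial>B x)"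
proof -
  interpret prob_space "B x" using x by (rule lawD)
  note [measurable_cong] = lawD(2)[OF x]
  note sp = lawD(3)[OF x]
  note [measurable] = Tm
  let ?u = "\<lambda>x. \<integral>\<omega>'. (\<Prod>k\<in>K. f k (\<omega>' k)) \<partial>B x"
  let ?A = "{\<omega> \<in> A. T \<omega> < \<infinity>}"
  have "?A = A \<inter> {\<omega> \<in> space (path_space X). T \<omega> < \<infinity>}"
    using sets.sets_into_space[OF A'] by auto
  also have "\<dots> \<in> sets (path_space X)"
    using A' by measurable
  finally have [measurable]: "?A \<in> sets (path_space X)" .
  have fm: "f k \<in> borel_measurable (restrict_space borel X)" if "k \<in> K" for k
    using K(3) that by (intro measurable_restrict_space1 borel_measurable_continuous_onI) (auto simp: unit_functions_def)
  have um: "?u \<in> borel_measurable (restrict_space borel X)"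
    by (intro borel_measurable_continuous_on_restrict cont K)
  have m1: "(\<lambda>\<omega>. ennreal (\<Prod>k\<in>K. f k (\<omega> (r \<omega> + k)))) \<in> borel_measurable (path_space X)"
    if r: "r \<in> borel_measurable (path_space X)" "\<And>\<omega>. 0 \<le> r \<omega>" for r
    using K(2) by (intro measurable_compose[OF borel_measurable_prod measurable_ennreal]
        measurable_compose[OF measurable_random_eval[OF r] fm]) auto
  have m2: "(\<lambda>\<omega>. ennreal (?u (\<omega> (r \<omega>)))) \<in> borel_measurable (path_space X)"
    if r: "r \<in> borel_measurable (path_space X)" "\<And>\<omega>. 0 \<le> r \<omega>" for r
    using measurable_compose[OF measurable_random_eval[OF r, of 0] um] by (auto intro: measurable_compose)
  have rT: "(\<lambda>\<omega>. enn2real (T \<omega>)) \<in> borel_measurable (path_space X)" by measurable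
  have rD: "(\<lambda>\<omega>. discretise m (enn2real (T \<omega>))) \<in> borel_measurable (path_space X)" for m
    unfolding discretise_def by measurable
  have "(\<lambda>m. \<integral>\<^sup>+\<omega>. ennreal (\<Prod>k\<in>K. f k (\<omega> (discretise m (enn2real (T \<omega>)) + k))) * indicator ?A \<omega> \<partial>B x)
      \<longlonglongrightarrow> (\<integral>\<^sup>+\<omega>. ennreal (\<Prod>k\<in>K. f k (\<omega> (enn2real (T \<omega>) + k))) * indicator ?A \<omega> \<partial>B x)"
  proof (rule nn_integral_dominated_convergence[where w = "\<lambda>_. 1"])
    note [measurable] = m1[OF rT] m1[OF rD, OF discretise_nonneg]
    show "(\<lambda>\<omega>. ennreal (\<Prod>k\<in>K. f k (\<omega> (discretise m (enn2real (T \<omega>)) + k))) * indicator ?A \<omega>) \<in> borel_measurable (B x)" for m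
      by measurable
    show "(\<lambda>\<omega>. ennreal (\<Prod>k\<in>K. f k (\<omega> (enn2real (T \<omega>) + k))) * indicator ?A \<omega>) \<in> borel_measurable (B x)"
      using m1[OF rT] by measurable
    show "AE \<omega> in B x. ennreal (\<Prod>k\<in>K. f k (\<omega> (discretise m (enn2real (T \<omega>)) + k))) * indicator ?A \<omega> \<le> 1" for m
      using K(3) by (intro AE_I2) (auto simp: indicator_def ennreal_le_1 unit_functions_def intro!: prod_le_1)
    show "AE \<omega> in B x. (\<lambda>m. ennreal (\<Prod>k\<in>K. f k (\<omega> (discretise m (enn2real (T \<omega>)) + k))) * indicator ?A \<omega>)
        \<longlonglongrightarrow> ennreal (\<Prod>k\<in>K. f k (\<omega> (enn2real (T \<omega>) + k))) * indicator ?A \<omega>"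
    proof (rule AE_I2)
      fix \<omega> assume "\<omega> \<in> space (B x)"
      then have \<omega>: "\<omega> \<in> space (path_space X)" using sp by simp
      have "(\<lambda>m. \<Prod>k\<in>K. f k (\<omega> (discretise m (enn2real (T \<omega>)) + k))) \<longlonglongrightarrow> (\<Prod>k\<in>K. f k (\<omega> (enn2real (T \<omega>) + k)))"
      proof (rule tendsto_prod)
        fix k assume k: "k \<in> K"
        have "isCont (f k) y" for y
          using K(3) k by (auto simp: unit_functions_def continuous_on_eq_continuous_at)
        then show "(\<lambda>m. f k (\<omega> (discretise m (enn2real (T \<omega>)) + k))) \<longlonglongrightarrow> f k (\<omega> (enn2real (T \<omega>) + k))"
          using k K(2) by (intro isCont_tendsto_compose[of _ "f k"] path_discretise_tendsto[OF \<omega>]) auto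
      qed
      then show "(\<lambda>m. ennreal (\<Prod>k\<in>K. f k (\<omega> (discretise m (enn2real (T \<omega>)) + k))) * indicator ?A \<omega>)
        \<longlonglongrightarrow> ennreal (\<Prod>k\<in>K. f k (\<omega> (enn2real (T \<omega>) + k))) * indicator ?A \<omega>"
        by (auto simp: indicator_def intro!: tendsto_ennrealI)
    qed
  qed (auto simp: emeasure_space_1)
  \<comment> \<open>Here the Feller property \<open>cont\<close> is decisive: the starting point of
    the inner expectation moves along the path, and its limit has to be taken inside
    \<open>?u\<close>.\<close>
  moreover have "(\<lambda>m. \<integral>\<^sup>+\<omega>. ennreal (?u (\<omega> (discretise m (enn2real (T \<omega>))))) * indicator ?A \<omega> \<partial>B x)
      \<longlonglongrightarrow> (\<integral>\<^sup>+\<omega>. ennreal (?u (\<omega> (enn2real (T \<omega>)))) * indicator ?A \<omega> \<partial>B x)"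
  proof (rule nn_integral_dominated_convergence[where w = "\<lambda>_. 1"])
    note [measurable] = m2[OF rT] m2[OF rD, OF discretise_nonneg]
    show "(\<lambda>\<omega>. ennreal (?u (\<omega> (discretise m (enn2real (T \<omega>))))) * indicator ?A \<omega>) \<in> borel_measurable (B x)" for m
      by measurable
    show "(\<lambda>\<omega>. ennreal (?u (\<omega> (enn2real (T \<omega>)))) * indicator ?A \<omega>) \<in> borel_measurable (B x)"
      using m2[OF rT] by measurable
    show "AE \<omega> in B x. ennreal (?u (\<omega> (discretise m (enn2real (T \<omega>))))) * indicator ?A \<omega> \<le> 1" for m
      using cylinder_expectation_range(2)[OF path_in[OF _ discretise_nonneg] K(2,3)]
      by (intro AE_I2) (auto simp: indicator_def ennreal_le_1 sp)
    show "AE \<omega> in B x. (\<lambda>m. ennreal (?u (\<omega> (discretise m (enn2real (T \<omega>))))) * indicator ?A \<omega>)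
        \<longlonglongrightarrow> ennreal (?u (\<omega> (enn2real (T \<omega>)))) * indicator ?A \<omega>"
    proof (rule AE_I2)
      fix \<omega> assume "\<omega> \<in> space (B x)"
      then have \<omega>: "\<omega> \<in> space (path_space X)" using sp by simp
      have "(\<lambda>m. ?u (\<omega> (discretise m (enn2real (T \<omega>))))) \<longlonglongrightarrow> ?u (\<omega> (enn2real (T \<omega>)))"
      proof (rule continuous_on_tendsto_compose[OF cont[OF K]])
        show "(\<lambda>m. \<omega> (discretise m (enn2real (T \<omega>)))) \<longlonglongrightarrow> \<omega> (enn2real (T \<omega>))"
          using path_discretise_tendsto[OF \<omega>, of "enn2real (T \<omega>)" 0] by simp
      qed (use path_in[OF \<omega>] discretise_nonneg in auto)
      then show "(\<lambda>m. ennreal (?u (\<omega> (discretise m (enn2real (T \<omega>))))) * indicator ?A \<omega>)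
        \<longlonglongrightarrow> ennreal (?u (\<omega> (enn2real (T \<omega>)))) * indicator ?A \<omega>"
        by (auto simp: indicator_def intro!: tendsto_ennrealI)
    qed
  qed (auto simp: emeasure_space_1)
  ultimately show ?thesis
    unfolding markov_discretised[OF x K T A] by (rule LIMSEQ_unique)
qed

text \<open>For fixed \<open>T\<close> and \<open>A\<close>, each side of the required identity is a
  finite measure evaluated at \<open>C\<close>: an image under the random shift, respectively a
  mixture of the laws \<open>B\<close>. The previous lemma makes them agree on product
  functionals.\<close>

lemma strong_markov_family: "strong_markov_family X B"
  unfolding strong_markov_family_def
proof (intro conjI ballI allI impI kernel start)
  fix x T A C
  assume x: "x \<in> X" and T: "stopping_time (path_filtration X) T"
    and A: "A \<in> sets (filtration.pre_sigma (space (path_space X)) (path_filtration X) T)"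
    and C[measurable]: "C \<in> sets (path_space X)"
  interpret prob_space "B x" using x by (rule lawD)
  note [measurable_cong] = lawD(2)[OF x]
  note sp = lawD(3)[OF x]
  have Tm[measurable]: "T \<in> borel_measurable (path_space X)"
    using T path_filtration_subset filtration.space_F[OF filtration_path_filtration]
    by (rule measurable_stopping_time)
  \<comment> \<open>At time \<open>\<top>\<close> the condition on \<open>T\<close> holds
    everywhere, so \<open>A\<close> itself is an event of the filtration.\<close>
  have A'[measurable]: "A \<in> sets (path_space X)"
    using filtration.sets_pre_sigmaD[OF filtration_path_filtration T A, of \<top>] path_filtration_subset by auto
  let ?r = "\<lambda>\<omega>. enn2real (T \<omega>)"
  let ?A = "{\<omega> \<in> A. T \<omega> < \<infinity>}"
  let ?D = "density (B x) (indicator ?A)"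
  have rT: "?r \<in> borel_measurable (path_space X)" by measurable
  have "?A = A \<inter> {\<omega> \<in> space (path_space X). T \<omega> < \<infinity>}"
    using sets.sets_into_space[OF A'] by auto
  also have "\<dots> \<in> sets (path_space X)" by measurable
  finally have Am[measurable]: "?A \<in> sets (path_space X)" .
  have shm[measurable]: "(\<lambda>\<omega>. shift (?r \<omega>) \<omega>) \<in> path_space X \<rightarrow>\<^sub>M path_space X"
    by (rule measurable_random_shift[OF rT]) simp
  have "(\<lambda>\<omega>. \<omega> (?r \<omega>)) \<in> path_space X \<rightarrow>\<^sub>M restrict_space borel X"
    using measurable_random_eval[OF rT, of 0] by simp
  from kernel_at_time_measurable[OF kernel this]
  have ker: "(\<lambda>\<omega>. B (\<omega> (?r \<omega>))) \<in> path_space X \<rightarrow>\<^sub>M subprob_algebra (path_space X)" .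
  have setsD: "sets ?D = sets (path_space X)"
    using lawD(2)[OF x] by simp
  have kerD: "(\<lambda>\<omega>. B (\<omega> (?r \<omega>))) \<in> ?D \<rightarrow>\<^sub>M subprob_algebra (path_space X)"
    using ker unfolding measurable_cong_sets[OF setsD refl] .
  have neD: "space ?D \<noteq> {}"
    using lawD(4)[OF x] by simp
  have setsb: "sets (?D \<bind> (\<lambda>\<omega>. B (\<omega> (?r \<omega>)))) = sets (path_space X)"
    using sets_bind[of ?D "\<lambda>\<omega>. B (\<omega> (?r \<omega>))" "path_space X", OF _ neD] sets_kernel[OF kerD] by simp
  have "subprob_space ?D"
  proof (rule subprob_spaceI)
    have "emeasure ?D (space ?D) = (\<integral>\<^sup>+\<omega>. indicator ?A \<omega> * indicator (space ?D) \<omega> \<partial>B x)"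
      by (rule emeasure_density) auto
    also have "\<dots> \<le> (\<integral>\<^sup>+\<omega>. 1 \<partial>B x)"
      by (intro nn_integral_mono) (auto simp: indicator_def)
    also have "\<dots> = 1" by (simp add: emeasure_space_1)
    finally show "emeasure ?D (space ?D) \<le> 1" .
  qed (fact neD)
  have "distr ?D (path_space X) (\<lambda>\<omega>. shift (?r \<omega>) \<omega>) = ?D \<bind> (\<lambda>\<omega>. B (\<omega> (?r \<omega>)))"
  proof (rule measure_eqI_cylinder_functionals[of _ _ X "{0..}"])
    show "finite_measure (distr ?D (path_space X) (\<lambda>\<omega>. shift (?r \<omega>) \<omega>))"
      using \<open>subprob_space ?D\<close> by (intro finite_measure.finite_measure_distr subprob_space.axioms(1)) auto
    show "finite_measure (?D \<bind> (\<lambda>\<omega>. B (\<omega> (?r \<omega>))))"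
      using subprob_space_bind[OF \<open>subprob_space ?D\<close> kerD] subprob_space.axioms(1) by blast
    fix J f assume J: "finite J" "J \<subseteq> {0..}" "unit_functions J (f :: real \<Rightarrow> 'a \<Rightarrow> real)"
    note [measurable] = measurable_cylinder_functional[OF J(2,3)]
    have \<Phi>: "(\<lambda>\<omega>. ennreal (\<Prod>j\<in>J. f j (\<omega> j))) \<in> borel_measurable (path_space X)" by measurable
    have "(\<integral>\<^sup>+\<omega>. ennreal (\<Prod>j\<in>J. f j (\<omega> j)) \<partial>distr ?D (path_space X) (\<lambda>\<omega>. shift (?r \<omega>) \<omega>)) =
        (\<integral>\<^sup>+\<omega>. ennreal (\<Prod>j\<in>J. f j (shift (?r \<omega>) \<omega> j)) * indicator ?A \<omega> \<partial>B x)"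
      by (simp add: nn_integral_distr nn_integral_density mult.commute)
    also have "\<dots> = (\<integral>\<^sup>+\<omega>. ennreal (\<Prod>j\<in>J. f j (\<omega> (?r \<omega> + j))) * indicator ?A \<omega> \<partial>B x)"
      using J(2) by (auto intro!: nn_integral_cong arg_cong2[of _ _ _ _ "(*)"] arg_cong[of _ _ ennreal] prod.cong simp: shift_apply subset_iff)
    also have "\<dots> = (\<integral>\<^sup>+\<omega>. ennreal (\<integral>\<omega>'. (\<Prod>j\<in>J. f j (\<omega>' j)) \<partial>B (\<omega> (?r \<omega>))) * indicator ?A \<omega> \<partial>B x)"
      by (rule strong_markov_cylinder[OF x J T A Tm A'])
    also have "\<dots> = (\<integral>\<^sup>+\<omega>. (\<integral>\<^sup>+\<omega>'. ennreal (\<Prod>j\<in>J. f j (\<omega>' j)) \<partial>B (\<omega> (?r \<omega>))) * indicator ?A \<omega> \<partial>B x)"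
      using nn_integral_cylinder_functional[OF path_in J(2,3)] sp by (intro nn_integral_cong) simp
    also have "\<dots> = (\<integral>\<^sup>+\<omega>. (\<integral>\<^sup>+\<omega>'. ennreal (\<Prod>j\<in>J. f j (\<omega>' j)) \<partial>B (\<omega> (?r \<omega>))) \<partial>?D)"
      using measurable_compose[OF ker nn_integral_measurable_subprob_algebra[OF \<Phi>]]
      by (simp add: nn_integral_density mult.commute)
    also have "\<dots> = (\<integral>\<^sup>+\<omega>. ennreal (\<Prod>j\<in>J. f j (\<omega> j)) \<partial>(?D \<bind> (\<lambda>\<omega>. B (\<omega> (?r \<omega>)))))"
      by (rule nn_integral_bind[OF \<Phi> kerD, symmetric])
    finally show "(\<integral>\<^sup>+\<omega>. ennreal (\<Prod>j\<in>J. f j (\<omega> j)) \<partial>distr ?D (path_space X) (\<lambda>\<omega>. shift (?r \<omega>) \<omega>)) =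
      (\<integral>\<^sup>+\<omega>. ennreal (\<Prod>j\<in>J. f j (\<omega> j)) \<partial>(?D \<bind> (\<lambda>\<omega>. B (\<omega> (?r \<omega>)))))" .
  qed (auto simp: setsb[symmetric] sets_path_space[symmetric] setsb)
  then have "emeasure (distr ?D (path_space X) (\<lambda>\<omega>. shift (?r \<omega>) \<omega>)) C = emeasure (?D \<bind> (\<lambda>\<omega>. B (\<omega> (?r \<omega>)))) C"
    by simp
  moreover have "emeasure (?D \<bind> (\<lambda>\<omega>. B (\<omega> (?r \<omega>)))) C = (\<integral>\<^sup>+\<omega>. emeasure (B (\<omega> (?r \<omega>))) C * indicator ?A \<omega> \<partial>B x)"
    using measurable_emeasure_kernel[OF ker C] unfolding emeasure_bind[OF neD kerD C]
    by (simp add: nn_integral_density mult.commute)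
  moreover have "emeasure (distr ?D (path_space X) (\<lambda>\<omega>. shift (?r \<omega>) \<omega>)) C =
      emeasure (B x) {\<omega> \<in> A. T \<omega> < \<infinity> \<and> shift (?r \<omega>) \<omega> \<in> C}"
  proof -
    have eq: "{\<omega> \<in> A. T \<omega> < \<infinity> \<and> shift (?r \<omega>) \<omega> \<in> C} = ?A \<inter> ((\<lambda>\<omega>. shift (?r \<omega>) \<omega>) -` C \<inter> space (B x))"
      using sets.sets_into_space[OF A'] sp by auto
    have [measurable]: "(\<lambda>\<omega>. shift (?r \<omega>) \<omega>) -` C \<inter> space (B x) \<in> sets (B x)"
      by measurable
    have "emeasure (distr ?D (path_space X) (\<lambda>\<omega>. shift (?r \<omega>) \<omega>)) C =
       (\<integral>\<^sup>+\<omega>. indicator ?A \<omega> * indicator ((\<lambda>\<omega>. shift (?r \<omega>) \<omega>) -` C \<inter> space (B x)) \<omega> \<partial>B x)"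
      by (simp add: emeasure_distr emeasure_density)
    also have "\<dots> = emeasure (B x) (?A \<inter> ((\<lambda>\<omega>. shift (?r \<omega>) \<omega>) -` C \<inter> space (B x)))"
      unfolding indicator_inter_arith[symmetric] by (rule nn_integral_indicator) measurable
    finally show ?thesis unfolding eq .
  qed
  ultimately show "emeasure (B x) {\<omega> \<in> A. T \<omega> < \<infinity> \<and> shift (enn2real (T \<omega>)) \<omega> \<in> C} =
    (\<integral>\<^sup>+\<omega>. emeasure (B (\<omega> (enn2real (T \<omega>)))) C * indicator {\<omega> \<in> A. T \<omega> < \<infinity>} \<omega> \<partial>B x)"
    by simp
qed

end

section \<open>Passage to the limit\<close>

text \<open>The supremum metric dominates the distance of two paths at the single time
  \<open>t\<close>, so evaluation there does not increase distances.\<close>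

lemma continuous_map_path_eval:
  fixes X :: "'a::metric_space set" and h :: "'a \<Rightarrow> real"
  assumes h: "continuous_on X h" and t: "t \<in> {0..T}"
  shows "continuous_map (mtopology_of (cfunspace (top_of_set {0..T}) (submetric euclidean_metric X)))
    euclideanreal (\<lambda>\<omega>. h (\<omega> t))"
proof -
  let ?m = "cfunspace (top_of_set {0..T}) (submetric euclidean_metric X)"
  interpret Metric_space "mspace ?m" "mdist ?m" by (rule Metric_space_mspace_mdist)
  show ?thesis
    unfolding mtopology_of_def continuous_map_from_metric
  proof (intro conjI ballI allI impI)
    fix \<omega> U assume \<omega>: "\<omega> \<in> mspace ?m" and U: "openin euclideanreal U \<and> h (\<omega> t) \<in> U"
    have val: "\<eta> t \<in> X" if "\<eta> \<in> mspace ?m" for \<eta>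
      using that t by auto
    obtain e where e: "0 < e" "ball (h (\<omega> t)) e \<subseteq> U"
      using U open_contains_ball by (metis open_openin)
    obtain \<delta> where \<delta>: "0 < \<delta>" "\<And>y. y \<in> X \<Longrightarrow> dist y (\<omega> t) < \<delta> \<Longrightarrow> dist (h y) (h (\<omega> t)) < e"
      using h val[OF \<omega>] e(1) unfolding continuous_on_iff by metis
    have "h (\<eta> t) \<in> U" if \<eta>: "\<eta> \<in> mspace ?m" and d: "mdist ?m \<omega> \<eta> < \<delta>" for \<eta>
    proof -
      have "dist (\<omega> t) (\<eta> t) \<le> mdist ?m \<omega> \<eta>"
        using mdist_cfunspace_imp_mdist_le[OF \<omega> \<eta> order_refl, of t] t by simp
      then have "dist (h (\<eta> t)) (h (\<omega> t)) < e"
        using d \<delta>(2)[OF val[OF \<eta>]] by (simp add: dist_commute)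
      then show ?thesis
        using e(2) by (auto simp: dist_commute)
    qed
    then show "\<exists>r>0. \<forall>\<eta>. \<eta> \<in> mspace ?m \<and> mdist ?m \<omega> \<eta> < r \<longrightarrow> h (\<eta> t) \<in> U"
      using \<delta>(1) by blast
  qed auto
qed

text \<open>The factors are assumed continuous on \<open>X\<close> only, because one of them will be
  the limit expectation, about which nothing is known off \<open>X\<close>. Compactness supplies the
  bounds that make the product an admissible test functional.\<close>

lemma weakly_converges_product:
  fixes X :: "'a::metric_space set"
  assumes X: "compact X" and w: "weakly_converges X N M"
    and J: "finite J" "J \<subseteq> {0..}" "\<And>j. j \<in> J \<Longrightarrow> continuous_on X (g j)"
    and K: "finite K" "K \<subseteq> {0..}" "\<And>k. k \<in> K \<Longrightarrow> continuous_on X (f k)" and s: "0 \<le> s"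
  shows "(\<lambda>n. \<integral>\<omega>. (\<Prod>j\<in>J. g j (\<omega> j)) * (\<Prod>k\<in>K. f k (\<omega> (s + k))) \<partial>N n)
    \<longlonglongrightarrow> (\<integral>\<omega>. (\<Prod>j\<in>J. g j (\<omega> j)) * (\<Prod>k\<in>K. f k (\<omega> (s + k))) \<partial>M :: real)"
proof -
  let ?\<Phi> = "\<lambda>\<omega>. (\<Prod>j\<in>J. g j (\<omega> j)) * (\<Prod>k\<in>K. f k (\<omega> (s + k)))"
  \<comment> \<open>Times are nonnegative, so each is at most the sum of all of them; the summand 1
    keeps the horizon positive even without any times.\<close>
  define T where "T = 1 + sum id J + s + sum id K"
  have sums: "0 \<le> sum id J" "0 \<le> sum id K"
    using J(2) K(2) by (auto intro!: sum_nonneg)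
  have JT: "j \<in> {0..T}" if "j \<in> J" for j
  proof -
    have "id j \<le> sum id J"
      using J that by (intro member_le_sum) auto
    then show ?thesis using that J(2) sums s by (auto simp: T_def)
  qed
  have KT: "s + k \<in> {0..T}" if "k \<in> K" for k
  proof -
    have "id k \<le> sum id K"
      using K that by (intro member_le_sum) auto
    then show ?thesis using that K(2) sums s by (auto simp: T_def)
  qed
  have T: "T > 0" using sums s by (simp add: T_def)
  let ?C = "mtopology_of (cfunspace (top_of_set {0..T}) (submetric euclidean_metric X))"
  have cont: "continuous_map ?C euclideanreal ?\<Phi>"
    using J K JT KT by (intro continuous_map_real_mult continuous_map_prod continuous_map_path_eval) auto
  have bound: "\<exists>b. \<forall>x\<in>X. \<bar>h x\<bar> \<le> b" if "continuous_on X h" for h :: "'a \<Rightarrow> real"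
    using compact_imp_bounded[OF compact_continuous_image[OF that X]] by (auto simp: bounded_iff)
  obtain bg where bg: "\<And>j x. j \<in> J \<Longrightarrow> x \<in> X \<Longrightarrow> \<bar>g j x\<bar> \<le> bg j"
    using bound[OF J(3)] by metis
  obtain bf where bf: "\<And>k x. k \<in> K \<Longrightarrow> x \<in> X \<Longrightarrow> \<bar>f k x\<bar> \<le> bf k"
    using bound[OF K(3)] by metis
  have "bounded (?\<Phi> ` topspace ?C)"
    unfolding bounded_iff
  proof (intro exI ballI)
    fix z assume "z \<in> ?\<Phi> ` topspace ?C"
    then obtain \<omega> where \<omega>: "\<omega> \<in> {0..T} \<rightarrow> X" and z: "z = ?\<Phi> \<omega>"
      by auto
    have 1: "\<bar>\<Prod>j\<in>J. g j (\<omega> j)\<bar> \<le> (\<Prod>j\<in>J. bg j)"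
      unfolding abs_prod using bg JT \<omega> by (intro prod_mono) (simp add: Pi_iff)
    have 2: "\<bar>\<Prod>k\<in>K. f k (\<omega> (s + k))\<bar> \<le> (\<Prod>k\<in>K. bf k)"
      unfolding abs_prod using bf KT \<omega> by (intro prod_mono) (simp add: Pi_iff)
    show "norm z \<le> (\<Prod>j\<in>J. bg j) * (\<Prod>k\<in>K. bf k)"
      unfolding z real_norm_def abs_mult using 1 2 by (intro mult_mono) auto
  qed
  then have "(\<lambda>n. \<integral>\<omega>. ?\<Phi> (restrict \<omega> {0..T}) \<partial>N n) \<longlonglongrightarrow> (\<integral>\<omega>. ?\<Phi> (restrict \<omega> {0..T}) \<partial>M)"
    using w T cont unfolding weakly_converges_def Let_def by blast
  moreover have "?\<Phi> (restrict \<omega> {0..T}) = ?\<Phi> \<omega>" for \<omega>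
    using JT KT by simp
  ultimately show ?thesis by simp
qed

lemma strong_markov_family_kernel:
  assumes "strong_markov_family X P"
  shows "P \<in> restrict_space borel X \<rightarrow>\<^sub>M prob_algebra (path_space X)"
    and "x \<in> X \<Longrightarrow> P x \<in> space (prob_algebra (path_space X))"
proof -
  show *: "P \<in> restrict_space borel X \<rightarrow>\<^sub>M prob_algebra (path_space X)"
    using assms by (simp add: strong_markov_family_def)
  show "x \<in> X \<Longrightarrow> P x \<in> space (prob_algebra (path_space X))"
    using measurable_space[OF *, of x] by (simp add: space_restrict_space)
qed

text \<open>A strong Markov family need not have continuous expectations, so measurability is
  obtained from the kernel property, through extended nonnegative integrals.\<close>

lemma
  assumes P: "strong_markov_family X P" and K: "K \<subseteq> {0..}" "unit_functions K f"
  shows cylinder_expectation_measurable: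
      "(\<lambda>x. \<integral>\<omega>. (\<Prod>k\<in>K. f k (\<omega> k)) \<partial>P x) \<in> borel_measurable (restrict_space borel X)"
    and ennreal_cylinder_expectation: "x \<in> X \<Longrightarrow>
      ennreal (\<integral>\<omega>. (\<Prod>k\<in>K. f k (\<omega> k)) \<partial>P x) = (\<integral>\<^sup>+\<omega>. ennreal (\<Prod>k\<in>K. f k (\<omega> k)) \<partial>P x)"
proof -
  note ker = strong_markov_family_kernel[OF P]
  have meas: "(\<lambda>\<omega>. \<Prod>k\<in>K. f k (\<omega> k)) \<in> borel_measurable (path_space X)"
    using K by (rule measurable_cylinder_functional)
  show eq: "ennreal (\<integral>\<omega>. (\<Prod>k\<in>K. f k (\<omega> k)) \<partial>P x) = (\<integral>\<^sup>+\<omega>. ennreal (\<Prod>k\<in>K. f k (\<omega> k)) \<partial>P x)"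
    if x: "x \<in> X" for x
  proof (rule nn_integral_eq_integral[symmetric])
    note Px = prob_algebraD[OF ker(2)[OF x]]
    interpret prob_space "P x" by (rule Px)
    show "integrable (P x) (\<lambda>\<omega>. \<Prod>k\<in>K. f k (\<omega> k))"
    proof (rule integrable_const_bound[of _ 1])
      show "(\<lambda>\<omega>. \<Prod>k\<in>K. f k (\<omega> k)) \<in> borel_measurable (P x)"
        using meas unfolding measurable_cong_sets[OF Px(2) refl] .
    qed (use unit_functions_prod[OF K(2)] in auto)
  qed (use unit_functions_prod[OF K(2)] in auto)
  have "(\<lambda>x. \<integral>\<^sup>+\<omega>. ennreal (\<Prod>k\<in>K. f k (\<omega> k)) \<partial>P x) \<in> borel_measurable (restrict_space borel X)"
    by (rule measurable_compose[OF measurable_prob_algebraD[OF ker(1)] nn_integral_measurable_subprob_algebra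
          [OF measurable_compose[OF meas measurable_ennreal]]])
  then have "(\<lambda>x. enn2real (\<integral>\<^sup>+\<omega>. ennreal (\<Prod>k\<in>K. f k (\<omega> k)) \<partial>P x)) \<in> borel_measurable (restrict_space borel X)"
    by measurable
  then show "(\<lambda>x. \<integral>\<omega>. (\<Prod>k\<in>K. f k (\<omega> k)) \<partial>P x) \<in> borel_measurable (restrict_space borel X)"
  proof (rule measurable_cong[THEN iffD1, rotated])
    fix x assume "x \<in> space (restrict_space borel X)"
    then have "x \<in> X" by (simp add: space_restrict_space)
    then show "enn2real (\<integral>\<^sup>+\<omega>. ennreal (\<Prod>k\<in>K. f k (\<omega> k)) \<partial>P x) = (\<integral>\<omega>. (\<Prod>k\<in>K. f k (\<omega> k)) \<partial>P x)"
      using unit_functions_prod[OF K(2)] by (simp add: eq[symmetric] integral_nonneg_AE)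
  qed
qed

lemma strong_markov_family_cylinder:
  assumes P: "strong_markov_family X P" and x: "x \<in> X" and s: "0 \<le> s"
    and J: "J \<subseteq> {0..s}" "unit_functions J g" and K: "K \<subseteq> {0..}" "unit_functions K f"
  shows "(\<integral>\<omega>. (\<Prod>j\<in>J. g j (\<omega> j)) * (\<Prod>k\<in>K. f k (\<omega> (s + k))) \<partial>P x) =
    (\<integral>\<omega>. (\<Prod>j\<in>J. g j (\<omega> j)) * (\<integral>\<omega>'. (\<Prod>k\<in>K. f k (\<omega>' k)) \<partial>P (\<omega> s)) \<partial>P x)"
    (is "?L = ?R")
proof -
  let ?\<Psi> = "\<lambda>\<omega>. \<Prod>j\<in>J. g j (\<omega> j)" and ?\<Phi> = "\<lambda>\<omega>. \<Prod>k\<in>K. f k (\<omega> k)"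
  let ?v = "\<lambda>x. \<integral>\<omega>'. ?\<Phi> \<omega>' \<partial>P x"
  note Px = prob_algebraD[OF strong_markov_family_kernel(2)[OF P x]]
  note [measurable_cong] = Px(2)
  have J0: "J \<subseteq> {0..}" using J(1) by auto
  have [measurable]: "?\<Psi> \<in> borel_measurable (path_space X)"
    using J0 J(2) by (rule measurable_cylinder_functional)
  have \<Phi>[measurable]: "?\<Phi> \<in> borel_measurable (path_space X)"
    using K by (rule measurable_cylinder_functional)
  have [measurable]: "(\<lambda>\<omega>. \<Prod>k\<in>K. f k (\<omega> (s + k))) \<in> borel_measurable (path_space X)"
    using K s by (rule measurable_shifted_functional)
  have [measurable]: "(\<lambda>\<omega>. ?v (\<omega> s)) \<in> borel_measurable (path_space X)"
    by (rule measurable_compose[OF measurable_path_eval[OF s] cylinder_expectation_measurable[OF P K]])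
  have \<Psi>F: "(\<lambda>\<omega>. ennreal (?\<Psi> \<omega>)) \<in> borel_measurable (natural_filtration X s)"
  proof (rule measurable_compose[OF measurable_prod_functional[OF J(2)] measurable_ennreal])
    show "(\<lambda>\<omega>. \<omega> j) \<in> natural_filtration X s \<rightarrow>\<^sub>M borel" if "j \<in> J" for j
      by (rule eval_measurable_sigma_cylinders[OF sets_natural_filtration]) (use that J(1) in auto)
  qed
  note ranges = unit_functions_prod[OF J(2)] unit_functions_shifted_prod[OF K(2)] unit_functions_prod[OF K(2)]
  have vnn: "0 \<le> ?v y" for y
    using ranges by (intro integral_nonneg_AE) auto
  have "?L = enn2real (\<integral>\<^sup>+\<omega>. ennreal (?\<Psi> \<omega> * (\<Prod>k\<in>K. f k (\<omega> (s + k)))) \<partial>P x)"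
    using ranges by (intro integral_eq_nn_integral) auto
  also have "(\<integral>\<^sup>+\<omega>. ennreal (?\<Psi> \<omega> * (\<Prod>k\<in>K. f k (\<omega> (s + k)))) \<partial>P x) =
      (\<integral>\<^sup>+\<omega>. ennreal (?\<Phi> (shift s \<omega>)) * ennreal (?\<Psi> \<omega>) \<partial>P x)"
  proof (rule nn_integral_cong)
    fix \<omega>
    have "?\<Phi> (shift s \<omega>) = (\<Prod>k\<in>K. f k (\<omega> (s + k)))"
      using K(1) by (intro prod.cong) (auto simp: shift_apply)
    then show "ennreal (?\<Psi> \<omega> * (\<Prod>k\<in>K. f k (\<omega> (s + k)))) = ennreal (?\<Phi> (shift s \<omega>)) * ennreal (?\<Psi> \<omega>)"
      using ranges by (simp add: ennreal_mult mult.commute)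
  qed
  also have "\<dots> = (\<integral>\<^sup>+\<omega>. (\<integral>\<^sup>+\<omega>'. ennreal (?\<Phi> \<omega>') \<partial>P (\<omega> s)) * ennreal (?\<Psi> \<omega>) \<partial>P x)"
    using \<Phi> by (intro strong_markov_fixed_time[OF P x s _ \<Psi>F]) measurable
  also have "\<dots> = (\<integral>\<^sup>+\<omega>. ennreal (?\<Psi> \<omega> * ?v (\<omega> s)) \<partial>P x)"
  proof (rule nn_integral_cong)
    fix \<omega> assume "\<omega> \<in> space (P x)"
    then have "\<omega> s \<in> X" using path_in[of \<omega> X s] s Px(3) by simp
    then show "(\<integral>\<^sup>+\<omega>'. ennreal (?\<Phi> \<omega>') \<partial>P (\<omega> s)) * ennreal (?\<Psi> \<omega>) = ennreal (?\<Psi> \<omega> * ?v (\<omega> s))"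
      using ennreal_cylinder_expectation[OF P K, of "\<omega> s"] ranges vnn by (simp add: ennreal_mult mult.commute)
  qed
  also have "enn2real \<dots> = ?R"
    using ranges vnn by (intro integral_eq_nn_integral[symmetric]) auto
  finally show ?thesis .
qed

section \<open>Limits of Markov families with varying state spaces\<close>

text \<open>The families \<open>P n\<close> live on the path spaces of different sets
  \<open>S n\<close>. The common ground is weak convergence, which compares integrals of functionals
  of paths in \<open>X\<close>, along all sequences of starting points.\<close>

locale markov_approximation =
  fixes X :: "'a::metric_space set" and S :: "nat \<Rightarrow> 'a set"
    and P :: "nat \<Rightarrow> 'a \<Rightarrow> (real \<Rightarrow> 'a) measure" and B :: "'a \<Rightarrow> (real \<Rightarrow> 'a) measure"
  assumes compact: "compact X" and S: "S n \<subseteq> X"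
    and dense: "x \<in> X \<Longrightarrow> \<exists>y. (\<forall>n. y n \<in> S n) \<and> y \<longlonglongrightarrow> x"
    and P: "strong_markov_family (S n) (P n)"
    and law: "x \<in> X \<Longrightarrow> B x \<in> space (prob_algebra (path_space X))"
    and conv: "x \<in> X \<Longrightarrow> (\<And>n. y n \<in> S n) \<Longrightarrow> y \<longlonglongrightarrow> x \<Longrightarrow> weakly_converges X (\<lambda>n. P n (y n)) (B x)"
begin

lemma product_tendsto:
  assumes "x \<in> X" "\<And>n. y n \<in> S n" "y \<longlonglongrightarrow> x"
    and K: "finite K" "K \<subseteq> {0..}" "\<And>k. k \<in> K \<Longrightarrow> continuous_on X (f k)"
  shows "(\<lambda>n. \<integral>\<omega>. (\<Prod>k\<in>K. f k (\<omega> k)) \<partial>P n (y n)) \<longlonglongrightarrow> (\<integral>\<omega>. (\<Prod>k\<in>K. f k (\<omega> k)) \<partial>B x :: real)"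
  using weakly_converges_product[OF compact conv[OF assms(1-3)], of "{}" _ K f 0] K by simp

lemma product_continuous:
  assumes K: "finite K" "K \<subseteq> {0..}" "\<And>k. k \<in> K \<Longrightarrow> continuous_on X (f k)"
  shows "continuous_on X (\<lambda>x. \<integral>\<omega>. (\<Prod>k\<in>K. f k (\<omega> k)) \<partial>B x :: real)"
  using compact S dense product_tendsto[OF _ _ _ K]
  by (rule continuous_convergence_imp_continuous[where v = "\<lambda>n y. \<integral>\<omega>. (\<Prod>k\<in>K. f k (\<omega> k)) \<partial>P n y"])

lemma product_uniform:
  assumes K: "finite K" "K \<subseteq> {0..}" "\<And>k. k \<in> K \<Longrightarrow> continuous_on X (f k)" and "0 < \<epsilon>"
  shows "\<forall>\<^sub>F n in sequentially. \<forall>y\<in>S n.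
    \<bar>(\<integral>\<omega>. (\<Prod>k\<in>K. f k (\<omega> k)) \<partial>P n y) - (\<integral>\<omega>. (\<Prod>k\<in>K. f k (\<omega> k)) \<partial>B y)\<bar> < (\<epsilon> :: real)"
  using compact S dense product_tendsto[OF _ _ _ K] \<open>0 < \<epsilon>\<close>
  by (rule continuous_convergence_imp_uniform[where v = "\<lambda>n y. \<integral>\<omega>. (\<Prod>k\<in>K. f k (\<omega> k)) \<partial>P n y"])

text \<open>The expected distance of the initial position from \<open>x\<close> equals
  \<open>dist x (y n)\<close> under the approximating laws, hence is 0 in the limit; a nonnegative
  function with integral 0 vanishes almost everywhere.\<close>

lemma start_limit:
  assumes x: "x \<in> X"
  shows "AE \<omega> in B x. \<omega> 0 = x"
proof -
  obtain y where y: "\<And>n. y n \<in> S n" "y \<longlonglongrightarrow> x" using dense x by blast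
  note Bx = prob_algebraD[OF law[OF x]]
  interpret prob_space "B x" by (rule Bx)
  have "continuous_on X (\<lambda>z. dist x z)" by (intro continuous_intros)
  then have "(\<lambda>n. \<integral>\<omega>. dist x (\<omega> 0) \<partial>P n (y n)) \<longlonglongrightarrow> (\<integral>\<omega>. dist x (\<omega> 0) \<partial>B x)"
    using product_tendsto[OF x y, of "{0}" "\<lambda>_ z. dist x z"] by simp
  moreover have "(\<integral>\<omega>. dist x (\<omega> 0) \<partial>P n (y n)) = dist x (y n)" for n
  proof -
    note Py = prob_algebraD[OF strong_markov_family_kernel(2)[OF P y(1)]]
    interpret Q: prob_space "P n (y n)" by (rule Py)
    have m: "(\<lambda>\<omega>. dist x (\<omega> 0)) \<in> borel_measurable (P n (y n))"
      unfolding measurable_cong_sets[OF Py(2) refl]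
      by (rule measurable_compose[OF measurable_path_eval_borel[OF order_refl]
            borel_measurable_continuous_onI]) (intro continuous_intros)
    have "AE \<omega> in P n (y n). \<omega> 0 = y n"
      using P[of n] y(1)[of n] by (simp add: strong_markov_family_def)
    then have "(\<integral>\<omega>. dist x (\<omega> 0) \<partial>P n (y n)) = (\<integral>\<omega>. dist x (y n) \<partial>P n (y n))"
      using m by (intro integral_cong_AE) auto
    then show ?thesis by (simp add: Q.prob_space)
  qed
  moreover have "(\<lambda>n. dist x (y n)) \<longlonglongrightarrow> 0"
    using tendsto_dist[OF tendsto_const[of x] y(2)] by simp
  ultimately have int0: "(\<integral>\<omega>. dist x (\<omega> 0) \<partial>B x) = 0"
    using LIMSEQ_unique by fastforce
  have m: "(\<lambda>\<omega>. dist x (\<omega> 0)) \<in> borel_measurable (B x)"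
    unfolding measurable_cong_sets[OF Bx(2) refl]
    by (rule measurable_compose[OF measurable_path_eval_borel[OF order_refl]
          borel_measurable_continuous_onI]) (intro continuous_intros)
  obtain b where b: "\<And>z. z \<in> X \<Longrightarrow> dist x z \<le> b"
    using compact_imp_bounded[OF compact] unfolding bounded_any_center[of X x] by blast
  have "integrable (B x) (\<lambda>\<omega>. dist x (\<omega> 0))"
    using m b path_in[of _ X 0] Bx(3) by (intro integrable_const_bound[of _ b]) auto
  then have "AE \<omega> in B x. dist x (\<omega> 0) = 0"
    using int0 integral_nonneg_eq_0_iff_AE[of "B x" "\<lambda>\<omega>. dist x (\<omega> 0)"] by simp
  then show ?thesis by eventually_elim simp
qed

text \<open>The inner expectation \<open>v n\<close> varies with \<open>n\<close>. Replacing it by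
  its limit \<open>u\<close> changes the integral by at most the uniform distance on
  \<open>S n\<close>, and \<open>u\<close> is continuous, so that the replaced integrand is again a
  product functional.\<close>

lemma markov_limit:
  assumes x: "x \<in> X" and s: "0 \<le> s"
    and J: "finite J" "J \<subseteq> {0..s}" "unit_functions J g" and K: "finite K" "K \<subseteq> {0..}" "unit_functions K f"
  shows "(\<integral>\<omega>. (\<Prod>j\<in>J. g j (\<omega> j)) * (\<Prod>k\<in>K. f k (\<omega> (s + k))) \<partial>B x) =
    (\<integral>\<omega>. (\<Prod>j\<in>J. g j (\<omega> j)) * (\<integral>\<omega>'. (\<Prod>k\<in>K. f k (\<omega>' k)) \<partial>B (\<omega> s)) \<partial>B x)"
proof -
  let ?\<Psi> = "\<lambda>\<omega>. \<Prod>j\<in>J. g j (\<omega> j)"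
  define u where "u y = (\<integral>\<omega>. (\<Prod>k\<in>K. f k (\<omega> k)) \<partial>B y)" for y
  define v where "v n y = (\<integral>\<omega>. (\<Prod>k\<in>K. f k (\<omega> k)) \<partial>P n y)" for n y
  obtain y where y: "\<And>n. y n \<in> S n" "y \<longlonglongrightarrow> x" using dense x by blast
  have J0: "J \<subseteq> {0..}" using J(2) by auto
  have gc: "continuous_on A (g j)" if "j \<in> J" for j A
    using unit_functions_continuous[OF J(3) that] .
  have fc: "continuous_on A (f k)" if "k \<in> K" for k A
    using unit_functions_continuous[OF K(3) that] .
  have u: "continuous_on X u"
    unfolding u_def using K fc by (intro product_continuous) auto
  note w = conv[OF x y]
  \<comment> \<open>The limit is taken on the side of the Markov identity that involves no inner
    expectation, and the identity for \<open>P n\<close> then rewrites the sequence.\<close>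
  have 1: "(\<lambda>n. \<integral>\<omega>. ?\<Psi> \<omega> * v n (\<omega> s) \<partial>P n (y n)) \<longlonglongrightarrow> (\<integral>\<omega>. ?\<Psi> \<omega> * (\<Prod>k\<in>K. f k (\<omega> (s + k))) \<partial>B x)"
    using weakly_converges_product[OF compact w J(1) J0 _ K(1,2) _ s, of g f] gc fc
    unfolding v_def strong_markov_family_cylinder[OF P y(1) s J(2,3) K(2,3)] by blast
  \<comment> \<open>The factor at time \<open>s\<close> is obtained from the shifted product over
    the single time 0, with \<open>u\<close> as its only function.\<close>
  have 2: "(\<lambda>n. \<integral>\<omega>. ?\<Psi> \<omega> * u (\<omega> s) \<partial>P n (y n)) \<longlonglongrightarrow> (\<integral>\<omega>. ?\<Psi> \<omega> * u (\<omega> s) \<partial>B x)"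
    using weakly_converges_product[OF compact w J(1) J0, of g "{0}" "\<lambda>_. u" s] gc u s by simp
  have "(\<lambda>n. (\<integral>\<omega>. ?\<Psi> \<omega> * v n (\<omega> s) \<partial>P n (y n)) - (\<integral>\<omega>. ?\<Psi> \<omega> * u (\<omega> s) \<partial>P n (y n))) \<longlonglongrightarrow> 0"
  proof (rule tendstoI)
    fix \<epsilon> :: real assume "0 < \<epsilon>"
    then have "\<forall>\<^sub>F n in sequentially. \<forall>z\<in>S n. \<bar>v n z - u z\<bar> < \<epsilon> / 2"
      unfolding u_def v_def using K fc by (intro product_uniform) auto
    then show "\<forall>\<^sub>F n in sequentially. dist ((\<integral>\<omega>. ?\<Psi> \<omega> * v n (\<omega> s) \<partial>P n (y n)) - (\<integral>\<omega>. ?\<Psi> \<omega> * u (\<omega> s) \<partial>P n (y n))) 0 < \<epsilon>"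
    proof eventually_elim
      case (elim n)
      note Py = prob_algebraD[OF strong_markov_family_kernel(2)[OF P y(1)], of n]
      interpret Q: prob_space "P n (y n)" by (rule Py)
      note [measurable_cong] = Py(2)
      have [measurable]: "?\<Psi> \<in> borel_measurable (path_space (S n))"
        using J0 J(3) by (rule measurable_cylinder_functional)
      have [measurable]: "(\<lambda>\<omega>. v n (\<omega> s)) \<in> borel_measurable (path_space (S n))"
        unfolding v_def
        by (rule measurable_compose[OF measurable_path_eval[OF s] cylinder_expectation_measurable[OF P K(2,3)]])
      have [measurable]: "(\<lambda>\<omega>. u (\<omega> s)) \<in> borel_measurable (path_space (S n))"
        by (rule measurable_compose[OF measurable_path_eval[OF s]
              borel_measurable_continuous_on_restrict[OF continuous_on_subset[OF u S]]])
      obtain b where b: "\<And>z. z \<in> X \<Longrightarrow> \<bar>u z\<bar> \<le> b"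
        using compact_imp_bounded[OF compact_continuous_image[OF u compact]] by (auto simp: bounded_iff)
      have inS: "\<omega> s \<in> S n" if "\<omega> \<in> space (P n (y n))" for \<omega>
        using path_in[of \<omega> "S n" s] s that Py(3) by simp
      note \<Psi>r = unit_functions_prod[OF J(3)]
      have bound: "\<bar>?\<Psi> \<omega> * c\<bar> \<le> \<bar>c\<bar>" for \<omega> c
        using \<Psi>r[of \<omega>] by (simp add: abs_mult mult_left_le_one_le)
      have iu: "integrable (P n (y n)) (\<lambda>\<omega>. ?\<Psi> \<omega> * u (\<omega> s))"
      proof (rule Q.integrable_const_bound[of _ b])
        show "AE \<omega> in P n (y n). norm (?\<Psi> \<omega> * u (\<omega> s)) \<le> b"
        proof (rule AE_I2)
          fix \<omega> assume "\<omega> \<in> space (P n (y n))"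
          then have "\<bar>u (\<omega> s)\<bar> \<le> b" using b inS S by blast
          then show "norm (?\<Psi> \<omega> * u (\<omega> s)) \<le> b"
            using bound[of \<omega> "u (\<omega> s)"] by simp
        qed
      qed measurable
      \<comment> \<open>No separate bound on \<open>v n\<close> is required: by uniform closeness it
        inherits the bound of \<open>u\<close> up to \<open>\<epsilon>\<close>.\<close>
      have iv: "integrable (P n (y n)) (\<lambda>\<omega>. ?\<Psi> \<omega> * v n (\<omega> s))"
      proof (rule Q.integrable_const_bound[of _ "b + \<epsilon>"])
        show "AE \<omega> in P n (y n). norm (?\<Psi> \<omega> * v n (\<omega> s)) \<le> b + \<epsilon>"
        proof (rule AE_I2)
          fix \<omega> assume \<omega>: "\<omega> \<in> space (P n (y n))"
          have "\<bar>u (\<omega> s)\<bar> \<le> b" using b inS[OF \<omega>] S by blast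
          then have "\<bar>v n (\<omega> s)\<bar> \<le> b + \<epsilon>"
            using elim[rule_format, OF inS[OF \<omega>]] \<open>0 < \<epsilon>\<close> by linarith
          then show "norm (?\<Psi> \<omega> * v n (\<omega> s)) \<le> b + \<epsilon>"
            using bound[of \<omega> "v n (\<omega> s)"] by simp
        qed
      qed measurable
      have "\<bar>(\<integral>\<omega>. ?\<Psi> \<omega> * v n (\<omega> s) \<partial>P n (y n)) - (\<integral>\<omega>. ?\<Psi> \<omega> * u (\<omega> s) \<partial>P n (y n))\<bar> =
          \<bar>\<integral>\<omega>. ?\<Psi> \<omega> * v n (\<omega> s) - ?\<Psi> \<omega> * u (\<omega> s) \<partial>P n (y n)\<bar>"
        using iu iv by simp
      also have "\<dots> \<le> (\<integral>\<omega>. \<bar>?\<Psi> \<omega> * v n (\<omega> s) - ?\<Psi> \<omega> * u (\<omega> s)\<bar> \<partial>P n (y n))"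
        by (rule integral_abs_bound)
      also have "\<dots> \<le> (\<integral>\<omega>. \<epsilon> / 2 \<partial>P n (y n))"
      proof (rule integral_mono)
        fix \<omega> assume "\<omega> \<in> space (P n (y n))"
        then show "\<bar>?\<Psi> \<omega> * v n (\<omega> s) - ?\<Psi> \<omega> * u (\<omega> s)\<bar> \<le> \<epsilon> / 2"
          using bound[of \<omega> "v n (\<omega> s) - u (\<omega> s)"] elim[rule_format, OF inS[of \<omega>]]
          by (simp add: right_diff_distrib)
      qed (use iu iv in auto)
      also have "\<dots> = \<epsilon> / 2" by (simp add: Q.prob_space)
      finally show ?case using \<open>0 < \<epsilon>\<close> by (simp add: dist_real_def)
    qed
  qed
  from LIMSEQ_unique[OF this tendsto_diff[OF 1 2]] show ?thesis
    unfolding u_def by simp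
qed

sublocale cylinder_markov X B
proof
  show "continuous_on X (\<lambda>x. \<integral>\<omega>. (\<Prod>j\<in>J. f j (\<omega> j)) \<partial>B x)"
    if "finite J" "J \<subseteq> {0..}" "unit_functions J f" for J f
    using that(1,2) unit_functions_continuous[OF that(3)] by (rule product_continuous)
qed (fact law start_limit markov_limit)+

end

section \<open>The Feller semigroup\<close>

context cylinder_markov
begin

text \<open>The function \<open>f\<close> may change sign and need not take values in the unit
  interval. Therefore the identity is read off from the equality of measures at time
  \<open>t\<close>, with the whole path space as the event of the past, using boundedness on the
  compact \<open>X\<close>.\<close>

lemma semigroup:
  assumes X: "compact X" and f: "continuous_on X f" and x: "x \<in> X" and t: "0 \<le> t" "0 \<le> s"
  shows "(\<integral>\<omega>. f (\<omega> (t + s)) \<partial>B x) = (\<integral>\<omega>. (\<integral>\<omega>'. f (\<omega>' s) \<partial>B (\<omega> t)) \<partial>B x :: real)"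
proof -
  interpret prob_space "B x" using x by (rule lawD)
  note [measurable_cong] = lawD(2)[OF x]
  note sp = lawD(3)[OF x]
  let ?\<Omega> = "space (path_space X)"
  have \<Omega>: "?\<Omega> \<in> sets (natural_filtration X t)"
    using sets.top[of "natural_filtration X t"] by (simp add: space_natural_filtration)
  have "density (B x) (indicator ?\<Omega>) = density (B x) (\<lambda>_. 1)"
    by (rule density_cong) (auto simp: sp)
  then have D: "density (B x) (indicator ?\<Omega>) = B x"
    by (simp add: density_1)
  have eq: "distr (B x) (path_space X) (shift t) = B x \<bind> (\<lambda>\<omega>. B (\<omega> t))"
    using strong_markov_fixed_time_measure[OF strong_markov_family x t(1) \<Omega>] unfolding D .
  have fm: "(\<lambda>\<omega>. f (\<omega> s)) \<in> borel_measurable (path_space X)"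
    by (rule measurable_compose[OF measurable_path_eval[OF t(2)] borel_measurable_continuous_on_restrict[OF f]])
  have ker: "(\<lambda>\<omega>. B (\<omega> t)) \<in> B x \<rightarrow>\<^sub>M subprob_algebra (path_space X)"
    unfolding measurable_cong_sets[OF lawD(2)[OF x] refl]
    by (rule kernel_at_time_measurable[OF kernel measurable_path_eval[OF t(1)]])
  obtain b where b: "\<And>z. z \<in> X \<Longrightarrow> \<bar>f z\<bar> \<le> b"
    using compact_imp_bounded[OF compact_continuous_image[OF f X]] by (auto simp: bounded_iff)
  have "(\<integral>\<omega>. f (\<omega> (t + s)) \<partial>B x) = (\<integral>\<omega>. f (shift t \<omega> s) \<partial>B x)"
    using t by (simp add: shift_apply)
  also have "\<dots> = (\<integral>\<omega>. f (\<omega> s) \<partial>distr (B x) (path_space X) (shift t))"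
    using measurable_shift[OF t(1), of X] fm by (subst integral_distr) auto
  also have "\<dots> = (\<integral>\<omega>. (\<integral>\<omega>'. f (\<omega>' s) \<partial>B (\<omega> t)) \<partial>B x)"
    unfolding eq
  proof (rule integral_bind[OF fm _ ker])
    show "\<bar>f (\<omega> s)\<bar> \<le> b" if "\<omega> \<in> ?\<Omega>" for \<omega>
      using b path_in[OF that t(2)] by blast
    show "AE \<omega> in B x. emeasure (B (\<omega> t)) (space (B (\<omega> t))) \<le> ennreal 1"
      using prob_space.emeasure_space_1[OF lawD(1)[OF path_in[OF _ t(1)]]] sp by (intro AE_I2) simp
  qed unfold_locales
  finally show ?thesis .
qed

text \<open>The locale gives continuity in \<open>x\<close> only for products of unit functions, so
  continuity for general \<open>f\<close> is a hypothesis here. Strong continuity at 0 follows from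
  continuity of paths and dominated convergence.\<close>

lemma feller_semigroup:
  assumes X: "compact X"
    and fc: "\<And>t f. 0 \<le> t \<Longrightarrow> continuous_on X f \<Longrightarrow> continuous_on X (\<lambda>x. \<integral>\<omega>. f (\<omega> t) \<partial>B x :: real)"
  shows "feller_semigroup_on X (\<lambda>t f x. \<integral>\<omega>. f (\<omega> t) \<partial>B x)"
  unfolding feller_semigroup_on_def
proof (intro conjI allI impI ballI fc semigroup[OF X])
  fix f :: "'a \<Rightarrow> real" and x assume f: "continuous_on X f" and x: "x \<in> X"
  interpret prob_space "B x" using x by (rule lawD)
  note sp = lawD(3)[OF x]
  obtain b where b: "\<And>z. z \<in> X \<Longrightarrow> \<bar>f z\<bar> \<le> b"
    using compact_imp_bounded[OF compact_continuous_image[OF f X]] by (auto simp: bounded_iff)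
  have fm: "(\<lambda>\<omega>. f (\<omega> s)) \<in> borel_measurable (B x)" if "0 \<le> s" for s
    unfolding measurable_cong_sets[OF lawD(2)[OF x] refl]
    by (rule measurable_compose[OF measurable_path_eval[OF that] borel_measurable_continuous_on_restrict[OF f]])
  show "((\<lambda>t. \<integral>\<omega>. f (\<omega> t) \<partial>B x) \<longlongrightarrow> f x) (at_right 0)"
    \<comment> \<open>Passing to sequences of times makes dominated convergence applicable.\<close>
    unfolding tendsto_at_iff_sequentially comp_def
  proof (intro allI impI)
    fix r :: "nat \<Rightarrow> real" assume r: "\<forall>i. r i \<in> {0<..} - {0}" "r \<longlonglongrightarrow> 0"
    have "(\<lambda>i. \<integral>\<omega>. f (\<omega> (r i)) \<partial>B x) \<longlonglongrightarrow> (\<integral>\<omega>. f (\<omega> 0) \<partial>B x)"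
    proof (rule integral_dominated_convergence[where w = "\<lambda>_. b"])
      show "AE \<omega> in B x. (\<lambda>i. f (\<omega> (r i))) \<longlonglongrightarrow> f (\<omega> 0)"
      proof (rule AE_I2)
        fix \<omega> assume "\<omega> \<in> space (B x)"
        then have \<omega>: "\<omega> \<in> space (path_space X)" using sp by simp
        have ri: "0 \<le> r i" for i using r(1) by (simp add: less_imp_le)
        have "(\<lambda>i. \<omega> (r i)) \<longlonglongrightarrow> \<omega> 0"
          by (rule continuous_on_tendsto_compose[OF path_continuous[OF \<omega>] r(2)]) (use ri in auto)
        then show "(\<lambda>i. f (\<omega> (r i))) \<longlonglongrightarrow> f (\<omega> 0)"
          by (rule continuous_on_tendsto_compose[OF f]) (use ri path_in[OF \<omega>] in auto)
      qed
      show "AE \<omega> in B x. norm (f (\<omega> (r i))) \<le> b" for i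
        using b path_in[of _ X "r i"] r(1) sp by (intro AE_I2) (simp add: less_imp_le)
    qed (use r(1) in \<open>auto intro!: fm simp: less_imp_le\<close>)
    also have "(\<integral>\<omega>. f (\<omega> 0) \<partial>B x) = (\<integral>\<omega>. f x \<partial>B x)"
      using start[OF x] fm[of 0] by (intro integral_cong_AE) auto
    finally show "(\<lambda>i. \<integral>\<omega>. f (\<omega> (r i)) \<partial>B x) \<longlonglongrightarrow> f x"
      by (simp add: prob_space)
  qed
qed

end

section \<open>One-point spaces and existence of an approximation\<close>

text \<open>A one-point space carries only one path, so uniqueness of the law cannot be used to
  extract a graph approximation. All functionals are constant there and the axioms hold
  directly.\<close>

lemma cylinder_markov_singleton:
  assumes law: "B a \<in> space (prob_algebra (path_space {a}))"
  shows "cylinder_markov {a} B"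
proof
  note Ba = prob_algebraD[OF law]
  interpret prob_space "B a" by (rule Ba)
  have val: "\<omega> t = a" if "\<omega> \<in> space (B a)" "0 \<le> t" for \<omega> t
    using path_in[of \<omega> "{a}" t] that Ba(3) by simp
  show "x \<in> {a} \<Longrightarrow> B x \<in> space (prob_algebra (path_space {a}))" for x
    using law by simp
  show "x \<in> {a} \<Longrightarrow> AE \<omega> in B x. \<omega> 0 = x" for x
    using val by (auto intro: AE_I2)
  fix x and s :: real and J K :: "real set" and f g :: "real \<Rightarrow> 'a \<Rightarrow> real"
  show "continuous_on {a} (\<lambda>x. \<integral>\<omega>. (\<Prod>j\<in>J. f j (\<omega> j)) \<partial>B x)" by simp
  assume "x \<in> {a}" and s: "0 \<le> s" and K: "K \<subseteq> {0..}"
  have "(\<integral>\<omega>. (\<Prod>k\<in>K. f k (\<omega> k)) \<partial>B a) = (\<integral>\<omega>. (\<Prod>k\<in>K. f k a) \<partial>B a)"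
    using val K by (intro Bochner_Integration.integral_cong prod.cong) auto
  then have u: "(\<integral>\<omega>. (\<Prod>k\<in>K. f k (\<omega> k)) \<partial>B a) = (\<Prod>k\<in>K. f k a)"
    by (simp add: prob_space)
  have "(\<Prod>k\<in>K. f k (\<omega> (s + k))) = (\<integral>\<omega>'. (\<Prod>k\<in>K. f k (\<omega>' k)) \<partial>B (\<omega> s))" if "\<omega> \<in> space (B a)" for \<omega>
    unfolding val[OF that s] u using val[OF that] s K by (intro prod.cong) (auto simp: subset_iff)
  then show "(\<integral>\<omega>. (\<Prod>j\<in>J. g j (\<omega> j)) * (\<Prod>k\<in>K. f k (\<omega> (s + k))) \<partial>B x) =
      (\<integral>\<omega>. (\<Prod>j\<in>J. g j (\<omega> j)) * (\<integral>\<omega>'. (\<Prod>k\<in>K. f k (\<omega>' k)) \<partial>B (\<omega> s)) \<partial>B x)"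
    using \<open>x \<in> {a}\<close> by (auto intro!: Bochner_Integration.integral_cong)
qed

text \<open>If no graph approximation carried Brownian motions, every law would vacuously be a limit law,
  contradicting uniqueness.\<close>

lemma brownian_motion_law_approximation:
  assumes M: "brownian_motion_law X x M" and ab: "a \<in> X" "b \<in> X" "a \<noteq> b"
  obtains G P xs where "graph_approximation X G" "\<And>n. graph_brownian_motion (G n) (P n)"
    "\<And>n. xs n \<in> gspace (G n)"
proof (rule ccontr)
  assume "\<not> thesis"
  with that have "brownian_limit_law X x N" if "N \<in> space (prob_algebra (path_space X))" for N
    using that unfolding brownian_limit_law_def by blast
  then have uniq: "N = M" if "N \<in> space (prob_algebra (path_space X))" for N
    using M that unfolding brownian_motion_law_def by blast
  \<comment> \<open>The point masses at the constant paths in \<open>a\<close> and in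
    \<open>b\<close> are two different laws; the event of starting at \<open>a\<close> tells them
    apart.\<close>
  let ?c = "\<lambda>z. \<lambda>t\<in>{0::real..}. z"
  let ?A = "cylinder X {0} (\<lambda>_. {a})"
  have path: "?c z \<in> space (path_space X)" if "z \<in> X" for z
  proof -
    have "continuous_on {0..} (?c z)"
      by (rule continuous_on_eq[OF continuous_on_const[of _ z]]) auto
    then show ?thesis using that by (auto simp: space_path_space)
  qed
  have "return (path_space X) (?c z) = M" if "z \<in> X" for z
    using path[OF that] by (intro uniq) (simp add: space_prob_algebra prob_space_return)
  then have "emeasure (return (path_space X) (?c a)) ?A = emeasure (return (path_space X) (?c b)) ?A"
    using ab by simp
  moreover have "?A \<in> sets (path_space X)"
    by (rule closed_cylinder_in_sets) (auto simp: closed_cylinders_def)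
  moreover have "?c a \<in> ?A" "?c b \<notin> ?A"
    using path ab by (auto simp: cylinder_def)
  ultimately show False
    by (simp add: indicator_def)
qed

theorem theorem6p3:
  fixes X :: "'a::metric_space set"
    and B :: "'a \<Rightarrow> (real \<Rightarrow> 'a) measure"
  assumes "continuum X"
    and "graph_like X"
    and "hausdorff1 X < \<infinity>"
    and "\<And>x. x \<in> X \<Longrightarrow> brownian_motion_law X x (B x)"
  shows "feller_semigroup_on X (\<lambda>t f x. \<integral>\<omega>. f (\<omega> t) \<partial>B x) \<and> strong_markov_family X B"
proof -
  have X: "compact X" "X \<noteq> {}"
    using assms(1) by (auto simp: continuum_def)
  have limit: "brownian_limit_law X x (B x)" if "x \<in> X" for x
    using assms(4)[OF that] by (simp add: brownian_motion_law_def)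
  then have law: "B x \<in> space (prob_algebra (path_space X))" if "x \<in> X" for x
    using that by (simp add: brownian_limit_law_def)
  show ?thesis
  \<comment> \<open>With two distinct points, uniqueness of the law forces the existence of a graph
    approximation carrying Brownian motions; the remaining spaces are singletons.\<close>
  proof (cases "\<exists>a b. a \<in> X \<and> b \<in> X \<and> a \<noteq> b")
    case True
    then obtain a b where ab: "a \<in> X" "b \<in> X" "a \<noteq> b" by blast
    obtain G P xs where G: "graph_approximation X G" "\<And>n. graph_brownian_motion (G n) (P n)"
      and xs: "\<And>n. xs n \<in> gspace (G n)"
      using brownian_motion_law_approximation[OF assms(4)[OF ab(1)] ab] by metis
    interpret markov_approximation X "\<lambda>n. gspace (G n)" P B
    proof
      show "gspace (G n) \<subseteq> X" for n
        using G(1) by (simp add: graph_approximation_def)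
      show "\<exists>y. (\<forall>n. y n \<in> gspace (G n)) \<and> y \<longlonglongrightarrow> x" if "x \<in> X" for x
      proof -
        have "gspace (G n) \<noteq> {}" for n using xs by blast
        from graph_approximation_dense[OF X(1) assms(2) G(1) this that] show ?thesis by metis
      qed
      show "strong_markov_family (gspace (G n)) (P n)" for n
        using G(2) by (simp add: graph_brownian_motion_def)
      show "weakly_converges X (\<lambda>n. P n (y n)) (B x)"
        if "x \<in> X" "\<And>n. y n \<in> gspace (G n)" "y \<longlonglongrightarrow> x" for x y
        using limit[OF that(1)] that G unfolding brownian_limit_law_def by blast
    qed (fact X(1) law)+
    \<comment> \<open>The test functional with the single time \<open>t\<close> and the single
      factor \<open>f\<close>, for which no bound to the unit interval is imposed.\<close>
    have "continuous_on X (\<lambda>x. \<integral>\<omega>. f (\<omega> t) \<partial>B x)" if "0 \<le> t" "continuous_on X f" for t and f :: "'a \<Rightarrow> real"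
      using product_continuous[of "{t}" "\<lambda>_. f"] that by simp
    then show ?thesis
      using feller_semigroup[OF X(1)] strong_markov_family by blast
  next
    case False
    then obtain a where a: "X = {a}"
      using X(2) by blast
    interpret cylinder_markov X B
      unfolding a using law[of a] unfolding a by (intro cylinder_markov_singleton) simp
    show ?thesis
      using feller_semigroup[OF X(1)] strong_markov_family by (simp add: a)
  qed
qed

end
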